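(* Let $K$ be a field, let $E$ be an arbitrary directed graph, and let $I$ be a regular ideal of the Leavitt path algebra $L_K(E)$. Then $I$ is $\mathbb{Z}$-graded, i.e. $I=\bigoplus_{n\in\mathbb{Z}}\bigl(I\cap L_K(E)_n\bigr)$.
   Context: A graph $E=(E^0,E^1,r,s)$ consists of a countable set of vertices $E^0$, a countable set of edges $E^1$, and range and source maps $r,s:E^1\to E^0$. A nontrivial path is $\alpha=e_1\cdots e_n$ with $r(e_i)=s(e_{i+1})$ for $1\le i\le n-1$; its length is $|\alpha|=n$, $s(\alpha)=s(e_1)$, $r(\alpha)=r(e_n)$. Vertices are paths of length $0$ (with $s(v)=r(v)=v$). $E^*$ is the set of all finite paths. $E^0_{reg}$ is the set of vertices $v$ with $s^{-1}(v)$ nonempty and finite. The Leavitt path algebra $L_K(E)$ is the universal $K$-algebra generated by pairwise orthogonal idempotents $\{v:v\in E^0\}$ and elements $\{e,e^*:e\in E^1\}$ subject to: (1) $s(e)e=er(e)=e$ for all $e\in E^1$; (2) $r(e)e^*=e^*s(e)=e^*$ for all $e\in E^1$; (3) $e^*f=\delta_{e,f}\,r(e)$ for all $e,f\in E^1$; (4) $v=\sum_{e\in E^1,\,s(e)=v}ee^*$ for all $v\in E^0_{reg}$. For a path $\alpha=e_1\cdots e_n$, $\alpha^*=e_n^*\cdots e_1^*$, and $v^*=v$ for vertices. It is $\mathbb{Z}$-graded with homogeneous components $L_K(E)_n=\operatorname{span}_K\{\alpha\beta^*:\alpha,\beta\in E^*,\ |\alpha|-|\beta|=n\}$, $n\in\mathbb{Z}$.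 For a subset $X$ of an algebra $A$, $X^\perp=\{a\in A: ax=xa=0\text{ for all }x\in X\}$. A (two-sided) ideal $J\subseteq A$ is called regular if $J=J^{\perp\perp}$. *)

theory Defs
  imports
    "HOL-Library.Poly_Mapping"
    "HOL-Library.Countable_Set"
    "HOL-Algebra.FiniteProduct"
    "Graph_Theory.Arc_Walk"
begin

section \<open>Algebras without unit\<close>

text \<open>
  HOL-Algebra rings are unital, but a Leavitt path algebra has a unit only if the graph has
  finitely many vertices. The type \<open>'k\<close> of scalars is a field in all uses below.
\<close>

record ('a, 'k) nu_algebra = "'a partial_object" +
  alg_zero :: 'a ("\<zero>\<^sub>A\<index>")
  alg_add :: "'a \<Rightarrow> 'a \<Rightarrow> 'a" (infixl "\<boxplus>\<index>" 65)
  alg_mult :: "'a \<Rightarrow> 'a \<Rightarrow> 'a" (infixl "\<boxtimes>\<index>" 70)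
  alg_scale :: "'k \<Rightarrow> 'a \<Rightarrow> 'a" (infixr "\<boxdot>\<index>" 75)

definition alg_sum :: "('a, 'k, 'm) nu_algebra_scheme \<Rightarrow> ('i \<Rightarrow> 'a) \<Rightarrow> 'i set \<Rightarrow> 'a" where
  "alg_sum A f S = finprod \<lparr>carrier = carrier A, mult = alg_add A, one = alg_zero A\<rparr> f S"

definition alg_span :: "('a, 'k, 'm) nu_algebra_scheme \<Rightarrow> 'a set \<Rightarrow> 'a set" where
  "alg_span A X = {alg_sum A (\<lambda>x. c x \<boxdot>\<^bsub>A\<^esub> x) T | c T. finite T \<and> T \<subseteq> X}"

definition alg_ideal :: "('a, 'k, 'm) nu_algebra_scheme \<Rightarrow> 'a set \<Rightarrow> bool" where
  "alg_ideal A J \<longleftrightarrow>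
     J \<subseteq> carrier A \<and> \<zero>\<^sub>A\<^bsub>A\<^esub> \<in> J \<and>
     (\<forall>x\<in>J. \<forall>y\<in>J. x \<boxplus>\<^bsub>A\<^esub> y \<in> J) \<and>
     (\<forall>c. \<forall>x\<in>J. c \<boxdot>\<^bsub>A\<^esub> x \<in> J) \<and>
     (\<forall>a\<in>carrier A. \<forall>x\<in>J. a \<boxtimes>\<^bsub>A\<^esub> x \<in> J \<and> x \<boxtimes>\<^bsub>A\<^esub> a \<in> J)"

definition alg_ideal_generated :: "('a, 'k, 'm) nu_algebra_scheme \<Rightarrow> 'a set \<Rightarrow> 'a set" where
  "alg_ideal_generated A R = \<Inter>{J. alg_ideal A J \<and> R \<subseteq> J}"

definition alg_coset :: "('a, 'k, 'm) nu_algebra_scheme \<Rightarrow> 'a set \<Rightarrow> 'a \<Rightarrow> 'a set" where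
  "alg_coset A J x = {x \<boxplus>\<^bsub>A\<^esub> j | j. j \<in> J}"

text \<open>
  Operations on cosets are given as unions over all representatives; if \<open>J\<close> is an ideal of an
  algebra \<open>A\<close> these unions are again single cosets.
\<close>

definition alg_quotient ::
    "('a, 'k, 'm) nu_algebra_scheme \<Rightarrow> 'a set \<Rightarrow> ('a set, 'k) nu_algebra" where
  "alg_quotient A J =
     \<lparr>carrier = alg_coset A J ` carrier A,
      alg_zero = alg_coset A J \<zero>\<^sub>A\<^bsub>A\<^esub>,
      alg_add = (\<lambda>X Y. \<Union>x\<in>X. \<Union>y\<in>Y. alg_coset A J (x \<boxplus>\<^bsub>A\<^esub> y)),
      alg_mult = (\<lambda>X Y. \<Union>x\<in>X. \<Union>y\<in>Y. alg_coset A J (x \<boxtimes>\<^bsub>A\<^esub> y)),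
      alg_scale = (\<lambda>c X. \<Union>x\<in>X. alg_coset A J (c \<boxdot>\<^bsub>A\<^esub> x))\<rparr>"

definition alg_perp :: "('a, 'k, 'm) nu_algebra_scheme \<Rightarrow> 'a set \<Rightarrow> 'a set" where
  "alg_perp A X =
     {a \<in> carrier A. \<forall>x\<in>X. a \<boxtimes>\<^bsub>A\<^esub> x = \<zero>\<^sub>A\<^bsub>A\<^esub> \<and> x \<boxtimes>\<^bsub>A\<^esub> a = \<zero>\<^sub>A\<^bsub>A\<^esub>}"

definition regular_ideal :: "('a, 'k, 'm) nu_algebra_scheme \<Rightarrow> 'a set \<Rightarrow> bool" where
  "regular_ideal A J \<longleftrightarrow> alg_ideal A J \<and> J = alg_perp A (alg_perp A J)"

text \<open>
  \<open>S\<close> is the internal direct sum of the \<open>M i\<close>: summation is a bijection from the external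
  direct sum (finitely supported families) onto \<open>S\<close>.
\<close>

definition internal_direct_sum ::
    "('a, 'k, 'm) nu_algebra_scheme \<Rightarrow> ('i \<Rightarrow> 'a set) \<Rightarrow> 'a set \<Rightarrow> bool" where
  "internal_direct_sum A M S \<longleftrightarrow>
     bij_betw (\<lambda>f. alg_sum A f {i. f i \<noteq> \<zero>\<^sub>A\<^bsub>A\<^esub>})
       {f. (\<forall>i. f i \<in> M i) \<and> finite {i. f i \<noteq> \<zero>\<^sub>A\<^bsub>A\<^esub>}} S"


section \<open>Free algebras\<close>

datatype 'g word = Word (letters: "'g list")

instantiation word :: (type) monoid_add
begin

definition zero_word_def: "0 = Word []"

definition plus_word_def: "u + v = Word (letters u @ letters v)"

instance
  by standard (simp_all add: zero_word_def plus_word_def)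

end

text \<open>
  The multiplication of \<open>'g word \<Rightarrow>\<^sub>0 'k\<close> is convolution along concatenation of words. Excluding
  the empty word makes \<open>free_algebra X\<close> the free associative algebra without unit on \<open>X\<close>.
\<close>

definition free_algebra :: "'g set \<Rightarrow> ('g word \<Rightarrow>\<^sub>0 'k::field, 'k) nu_algebra" where
  "free_algebra X =
     \<lparr>carrier = {p. \<forall>w\<in>Poly_Mapping.keys p. letters w \<noteq> [] \<and> set (letters w) \<subseteq> X},
      alg_zero = 0, alg_add = (+), alg_mult = (*),
      alg_scale = (\<lambda>c. Poly_Mapping.map ((*) c))\<rparr>"


section \<open>Leavitt path algebras\<close>

text \<open>
  A directed graph is a \<^locale>\<open>wf_digraph\<close>, with \<^const>\<open>tail\<close> as source and \<^const>\<open>head\<close> as range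
  map.
\<close>

datatype ('v, 'e) lpa_gen = Vert 'v | Edge 'e | Ghost 'e

type_synonym ('v, 'e, 'k) lpa_free = "('v, 'e) lpa_gen word \<Rightarrow>\<^sub>0 'k"
type_synonym ('v, 'e, 'k) lpa_elem = "('v, 'e, 'k) lpa_free set"

definition lpa_gens :: "('v, 'e) pre_digraph \<Rightarrow> ('v, 'e) lpa_gen set" where
  "lpa_gens G = Vert ` verts G \<union> Edge ` arcs G \<union> Ghost ` arcs G"

definition word_elem :: "'g list \<Rightarrow> ('g word \<Rightarrow>\<^sub>0 'k::field)" where
  "word_elem xs = Poly_Mapping.single (Word xs) 1"

text \<open>The element \<open>p - q\<close> stands for the relation \<open>p = q\<close>.\<close>

inductive_set lpa_relations :: "('v, 'e) pre_digraph \<Rightarrow> ('v, 'e, 'k::field) lpa_free set"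
  for G :: "('v, 'e) pre_digraph" where
  vert_idem: "v \<in> verts G \<Longrightarrow>
    word_elem [Vert v, Vert v] - word_elem [Vert v] \<in> lpa_relations G"
| vert_orth: "v \<in> verts G \<Longrightarrow> w \<in> verts G \<Longrightarrow> v \<noteq> w \<Longrightarrow>
    word_elem [Vert v, Vert w] \<in> lpa_relations G"
| source_edge: "e \<in> arcs G \<Longrightarrow>
    word_elem [Vert (tail G e), Edge e] - word_elem [Edge e] \<in> lpa_relations G"
| edge_range: "e \<in> arcs G \<Longrightarrow>
    word_elem [Edge e, Vert (head G e)] - word_elem [Edge e] \<in> lpa_relations G"
| range_ghost: "e \<in> arcs G \<Longrightarrow>
    word_elem [Vert (head G e), Ghost e] - word_elem [Ghost e] \<in> lpa_relations G"
| ghost_source: "e \<in> arcs G \<Longrightarrow>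
    word_elem [Ghost e, Vert (tail G e)] - word_elem [Ghost e] \<in> lpa_relations G"
| ghost_edge_same: "e \<in> arcs G \<Longrightarrow>
    word_elem [Ghost e, Edge e] - word_elem [Vert (head G e)] \<in> lpa_relations G"
| ghost_edge_diff: "e \<in> arcs G \<Longrightarrow> f \<in> arcs G \<Longrightarrow> e \<noteq> f \<Longrightarrow>
    word_elem [Ghost e, Edge f] \<in> lpa_relations G"
| regular_vert: "v \<in> verts G \<Longrightarrow> out_arcs G v \<noteq> {} \<Longrightarrow> finite (out_arcs G v) \<Longrightarrow>
    word_elem [Vert v] - (\<Sum>e\<in>out_arcs G v. word_elem [Edge e, Ghost e]) \<in> lpa_relations G"

definition lpa_kernel :: "('v, 'e) pre_digraph \<Rightarrow> ('v, 'e, 'k::field) lpa_free set" where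
  "lpa_kernel G = alg_ideal_generated (free_algebra (lpa_gens G)) (lpa_relations G)"

definition leavitt_path_algebra ::
    "('v, 'e) pre_digraph \<Rightarrow> (('v, 'e, 'k::field) lpa_elem, 'k) nu_algebra" where
  "leavitt_path_algebra G = alg_quotient (free_algebra (lpa_gens G)) (lpa_kernel G)"

definition lpa_word ::
    "('v, 'e) pre_digraph \<Rightarrow> ('v, 'e) lpa_gen list \<Rightarrow> ('v, 'e, 'k::field) lpa_elem" where
  "lpa_word G xs = alg_coset (free_algebra (lpa_gens G)) (lpa_kernel G) (word_elem xs)"

text \<open>
  A path is given by its source \<open>u\<close> and its list \<open>p\<close> of edges, the empty list being the trivial
  path at \<open>u\<close>.
\<close>

definition lpa_path ::
    "('v, 'e) pre_digraph \<Rightarrow> 'v \<Rightarrow> 'e list \<Rightarrow> ('v, 'e, 'k::field) lpa_elem" where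
  "lpa_path G u p = lpa_word G (if p = [] then [Vert u] else map Edge p)"

definition lpa_path_star ::
    "('v, 'e) pre_digraph \<Rightarrow> 'v \<Rightarrow> 'e list \<Rightarrow> ('v, 'e, 'k::field) lpa_elem" where
  "lpa_path_star G u p = lpa_word G (if p = [] then [Vert u] else map Ghost (rev p))"

definition lpa_component ::
    "('v, 'e) pre_digraph \<Rightarrow> int \<Rightarrow> ('v, 'e, 'k::field) lpa_elem set" where
  "lpa_component G n =
     alg_span (leavitt_path_algebra G :: (('v, 'e, 'k) lpa_elem, 'k) nu_algebra)
       {lpa_path G u p \<boxtimes>\<^bsub>leavitt_path_algebra G :: (('v, 'e, 'k) lpa_elem, 'k) nu_algebra\<^esub>
          lpa_path_star G w q | u p v w q x.
          pre_digraph.awalk G u p v \<and> pre_digraph.awalk G w q x \<and>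
          int (length p) - int (length q) = n}"

end

theory Submission
  imports Defs
begin

text \<open>
  If \<open>b R a = 0\<close> in a graded ring \<open>R\<close> in which no nonzero homogeneous \<open>x\<close> satisfies \<open>x R x = 0\<close>,
  then \<open>b\<^sub>i R a\<^sub>j = 0\<close> for all homogeneous parts, by descent on the degree. Hence annihilators of
  ideals in such a ring are graded, and a regular ideal is the annihilator of its annihilator.

  A Leavitt path algebra is such a ring because every nonzero homogeneous \<open>x\<close> can be reduced to a
  nonzero multiple of a vertex: right multiplication by suitable edges turns \<open>x\<close> into a combination
  of paths of equal length, and left multiplication by \<open>\<alpha>\<^sup>*\<close> isolates the coefficient of the path
  \<open>\<alpha>\<close>. If \<open>r x s = k v\<close> with \<open>k \<noteq> 0\<close>, then \<open>r (x s r x) s = k\<^sup>2 v\<close>, which is nonzero. Elements of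
  the Leavitt path algebra are handled through representatives in the free algebra.
\<close>

section \<open>Finitely supported functions\<close>

text \<open>The hard case of the reduction is a homogeneous \<open>x\<close> with
  \<open>x f = 0\<close> for every edge \<open>f\<close>; otherwise multiplying by an edge shortens
  the ghost parts. Choose a vertex \<open>w\<close> with \<open>x w\<close> nonzero. If
  \<open>w\<close> is regular, \<open>x w\<close> is the sum of the \<open>x e e\<^sup>*\<close>,
  hence 0. If \<open>w\<close> emits infinitely many edges, some edge \<open>f\<close> from
  \<open>w\<close> starts none of the finitely many \<open>\<beta>\<close> in the terms
  \<open>\<alpha>\<beta>\<^sup>*\<close> of \<open>x\<close>. It sees only the terms ending at
  \<open>w\<close> without ghost part, and \<open>x f = 0\<close> makes them vanish; the other terms
  of \<open>x w\<close> are recovered from products \<open>x g g\<^sup>*\<close>, which are 0. So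
  \<open>w\<close> is a sink, and there \<open>x w\<close> is already a combination of paths.

  Working with a presentation raises two further questions. The degree has to descend to the
  quotient, which it does because all relations are homogeneous. The vertices must not collapse to
  0, which no rewriting with the relations can show; a concrete module settles it. Finally, the
  algebra need not have a unit, so finite sums of vertices act as local units.\<close>

lemma poly_mapping_sum_monomials:
  fixes p :: "'a \<Rightarrow>\<^sub>0 'b::comm_monoid_add"
  shows "p = (\<Sum>w\<in>Poly_Mapping.keys p. Poly_Mapping.single w (Poly_Mapping.lookup p w))"
proof (rule poly_mapping_eqI)
  fix k
  show "Poly_Mapping.lookup p k =
    Poly_Mapping.lookup (\<Sum>w\<in>Poly_Mapping.keys p. Poly_Mapping.single w (Poly_Mapping.lookup p w)) k"
    by (cases "k \<in> Poly_Mapping.keys p")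
      (auto simp: lookup_sum lookup_single when_def in_keys_iff)
qed

text \<open>Linear claims need checking on monomials only. The set \<open>W\<close> carries a
  restriction on the support through the induction, such as a fixed degree or a normal form.\<close>

lemma poly_mapping_monomial_induct [consumes 1, case_names zero add single]:
  fixes p :: "'a \<Rightarrow>\<^sub>0 'b::comm_monoid_add"
  assumes "Poly_Mapping.keys p \<subseteq> W"
    and zero: "P 0"
    and add: "\<And>p q. P p \<Longrightarrow> P q \<Longrightarrow> P (p + q)"
    and single: "\<And>w c. w \<in> W \<Longrightarrow> P (Poly_Mapping.single w c)"
  shows "P p"
proof -
  have "P (\<Sum>w\<in>S. Poly_Mapping.single w (Poly_Mapping.lookup p w))" if "finite S" "S \<subseteq> W" for S
    using that by induction (auto simp: zero add single)
  then show ?thesis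
    using assms(1) poly_mapping_sum_monomials[of p] by (metis finite_keys)
qed

section \<open>Ideals of free algebras\<close>

lemma letters_plus [simp]: "letters (u + v) = letters u @ letters v"
  by (simp add: plus_word_def)

lemma Word_plus: "Word xs + Word ys = Word (xs @ ys)"
  by (simp add: plus_word_def)

lemma word_elem_mult: "word_elem xs * word_elem ys = (word_elem (xs @ ys) :: _ \<Rightarrow>\<^sub>0 'k::field)"
  by (simp add: word_elem_def mult_single Word_plus)

text \<open>Scaling becomes multiplication by a monomial on the empty word, so that the ring laws
  apply. For \<open>c \<noteq> 0\<close> this factor lies outside the carrier, hence the separate
  closure rules for scaling.\<close>

lemma free_algebra_simps [simp]:
  "alg_zero (free_algebra X) = 0"
  "alg_add (free_algebra X) = (+)"
  "alg_mult (free_algebra X) = (*)"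
  "alg_scale (free_algebra X) c p = Poly_Mapping.single 0 c * p"
  by (simp_all add: free_algebra_def mult_map_scale_conv_mult)

lemma mem_carrier_free_algebra:
  "p \<in> carrier (free_algebra X) \<longleftrightarrow>
    Poly_Mapping.keys p \<subseteq> {w. letters w \<noteq> [] \<and> set (letters w) \<subseteq> X}"
  by (auto simp: free_algebra_def)

lemma scale_neg_one:
  fixes p :: "'g::monoid_add \<Rightarrow>\<^sub>0 'k::field"
  shows "Poly_Mapping.single 0 (-1) * p = - p"
  by (simp add: single_uminus)

lemma single_Word:
  "Poly_Mapping.single (Word xs) c = Poly_Mapping.single 0 c * (word_elem xs :: _ \<Rightarrow>\<^sub>0 'k::field)"
  by (simp add: word_elem_def mult_single)

lemma free_carrier_zero: "0 \<in> carrier (free_algebra X)"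
  by (simp add: mem_carrier_free_algebra)

lemma free_carrier_add:
  "p \<in> carrier (free_algebra X) \<Longrightarrow> q \<in> carrier (free_algebra X) \<Longrightarrow> p + q \<in> carrier (free_algebra X)"
  using keys_add[of p q] by (auto simp: mem_carrier_free_algebra)

lemma free_carrier_single:
  "letters w \<noteq> [] \<Longrightarrow> set (letters w) \<subseteq> X \<Longrightarrow> Poly_Mapping.single w c \<in> carrier (free_algebra X)"
  by (simp add: mem_carrier_free_algebra)

lemma free_carrier_word_elem:
  "xs \<noteq> [] \<Longrightarrow> set xs \<subseteq> X \<Longrightarrow> word_elem xs \<in> carrier (free_algebra X)"
  by (simp add: word_elem_def free_carrier_single)

lemma free_carrier_mult:
  "p \<in> carrier (free_algebra X) \<Longrightarrow> q \<in> carrier (free_algebra X) \<Longrightarrow> p * q \<in> carrier (free_algebra X)"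
  using keys_mult[of p q] by (fastforce simp: mem_carrier_free_algebra)

lemma free_carrier_scale:
  "p \<in> carrier (free_algebra X) \<Longrightarrow> Poly_Mapping.single 0 c * p \<in> carrier (free_algebra X)"
  using keys_mult[of "Poly_Mapping.single 0 c" p]
  by (cases "c = 0") (fastforce simp: mem_carrier_free_algebra)+

lemma free_carrier_uminus: "p \<in> carrier (free_algebra X) \<Longrightarrow> - p \<in> carrier (free_algebra X)"
  using free_carrier_scale[of p X "-1"] by (simp only: scale_neg_one)

lemma free_carrier_diff:
  "p \<in> carrier (free_algebra X) \<Longrightarrow> q \<in> carrier (free_algebra X) \<Longrightarrow> p - q \<in> carrier (free_algebra X)"
  using free_carrier_add[OF _ free_carrier_uminus] by fastforce

lemma free_carrier_sum:
  "(\<And>i. i \<in> S \<Longrightarrow> f i \<in> carrier (free_algebra X)) \<Longrightarrow> sum f S \<in> carrier (free_algebra X)"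
  by (induction S rule: infinite_finite_induct) (auto simp: free_carrier_zero free_carrier_add)

lemmas free_carrier_intros = free_carrier_zero free_carrier_add free_carrier_single
  free_carrier_word_elem free_carrier_mult free_carrier_scale free_carrier_uminus
  free_carrier_diff free_carrier_sum

lemma alg_ideal_free_carrier: "alg_ideal (free_algebra X) (carrier (free_algebra X))"
  by (simp add: alg_ideal_def free_carrier_intros)

text \<open>The assumption makes the carrier a member of the intersected family; the intersection of
  an empty family would be \<open>UNIV\<close>.\<close>

lemma alg_ideal_generated_ideal:
  assumes "R \<subseteq> carrier (free_algebra X)"
  shows "alg_ideal (free_algebra X) (alg_ideal_generated (free_algebra X) R)"
proof -
  have "alg_ideal_generated (free_algebra X) R \<subseteq> carrier (free_algebra X)"
    unfolding alg_ideal_generated_def using alg_ideal_free_carrier[of X] assms by blast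
  moreover have "\<forall>J\<in>{J. alg_ideal (free_algebra X) J \<and> R \<subseteq> J}. alg_ideal (free_algebra X) J"
    by simp
  ultimately show ?thesis
    unfolding alg_ideal_generated_def alg_ideal_def by blast
qed

lemma alg_ideal_generated_subset:
  "alg_ideal A J \<Longrightarrow> R \<subseteq> J \<Longrightarrow> alg_ideal_generated A R \<subseteq> J"
  by (auto simp: alg_ideal_generated_def)

lemma alg_ideal_generated_superset: "R \<subseteq> alg_ideal_generated A R"
  by (auto simp: alg_ideal_generated_def)

section \<open>The grading of the free algebra\<close>

text \<open>These weights give \<open>\<alpha>\<beta>\<^sup>*\<close> the degree
  \<open>|\<alpha>| - |\<beta>|\<close> and make every defining relation homogeneous.\<close>

fun letter_degree :: "('v, 'e) lpa_gen \<Rightarrow> int" where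
  "letter_degree (Vert v) = 0"
| "letter_degree (Edge e) = 1"
| "letter_degree (Ghost e) = -1"

definition word_degree :: "('v, 'e) lpa_gen word \<Rightarrow> int" where
  "word_degree w = sum_list (map letter_degree (letters w))"

lemma word_degree_plus [simp]: "word_degree (u + v) = word_degree u + word_degree v"
  by (simp add: word_degree_def)

lemma word_degree_zero [simp]: "word_degree 0 = 0"
  by (simp add: word_degree_def zero_word_def)

text \<open>The equation \<open>hom_part n p = p\<close> serves throughout as the predicate
  "homogeneous of degree \<open>n\<close>"; 0 satisfies it for every \<open>n\<close>.\<close>

definition hom_part :: "int \<Rightarrow> ('v, 'e, 'k::field) lpa_free \<Rightarrow> ('v, 'e, 'k) lpa_free" where
  "hom_part n = Poly_Mapping.mapp (\<lambda>w c. c when word_degree w = n)"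

lemma lookup_hom_part:
  "Poly_Mapping.lookup (hom_part n p) w = (Poly_Mapping.lookup p w when word_degree w = n)"
  by (auto simp: hom_part_def lookup_mapp when_def in_keys_iff)

lemma hom_part_zero [simp]: "hom_part n 0 = 0"
  by (rule poly_mapping_eqI) (simp add: lookup_hom_part)

lemma hom_part_add [simp]: "hom_part n (p + q) = hom_part n p + hom_part n q"
  by (rule poly_mapping_eqI) (simp add: lookup_hom_part lookup_add when_add_distrib)

lemma hom_part_uminus [simp]: "hom_part n (- p) = - hom_part n p"
  by (rule poly_mapping_eqI) (simp add: lookup_hom_part when_def)

lemma hom_part_diff [simp]: "hom_part n (p - q) = hom_part n p - hom_part n q"
  using hom_part_add[of n p "- q"] by simp

lemma hom_part_sum [simp]: "hom_part n (sum f S) = (\<Sum>i\<in>S. hom_part n (f i))"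
  by (induction S rule: infinite_finite_induct) auto

lemma hom_part_single:
  "hom_part n (Poly_Mapping.single w c) = (if word_degree w = n then Poly_Mapping.single w c else 0)"
  by (rule poly_mapping_eqI) (auto simp: lookup_hom_part lookup_single when_def)

lemma keys_hom_part: "Poly_Mapping.keys (hom_part n p) = {w \<in> Poly_Mapping.keys p. word_degree w = n}"
  by (auto simp: in_keys_iff lookup_hom_part)

lemma hom_part_hom_part: "hom_part m (hom_part n p) = (if m = n then hom_part n p else 0)"
  by (rule poly_mapping_eqI) (simp add: lookup_hom_part when_def)

lemma hom_part_carrier:
  "p \<in> carrier (free_algebra X) \<Longrightarrow> hom_part n p \<in> carrier (free_algebra X)"
  by (auto simp: mem_carrier_free_algebra keys_hom_part)

definition degrees :: "('v, 'e, 'k::field) lpa_free \<Rightarrow> int set" where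
  "degrees p = word_degree ` Poly_Mapping.keys p"

lemma finite_degrees [simp]: "finite (degrees p)"
  by (simp add: degrees_def)

lemma hom_part_eq_0: "n \<notin> degrees p \<Longrightarrow> hom_part n p = 0"
  by (rule poly_mapping_eqI) (auto simp: lookup_hom_part degrees_def in_keys_iff when_def)

lemma sum_hom_part:
  assumes "finite D" "degrees p \<subseteq> D"
  shows "(\<Sum>n\<in>D. hom_part n p) = p"
proof (rule poly_mapping_eqI)
  fix w
  have "word_degree w \<in> D" if "Poly_Mapping.lookup p w \<noteq> 0"
    using assms(2) that by (auto simp: degrees_def in_keys_iff)
  then show "Poly_Mapping.lookup (\<Sum>n\<in>D. hom_part n p) w = Poly_Mapping.lookup p w"
    using assms(1) by (auto simp: lookup_sum lookup_hom_part when_def)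
qed

lemma hom_part_eq_self_iff:
  "hom_part n p = p \<longleftrightarrow> Poly_Mapping.keys p \<subseteq> {w. word_degree w = n}"
proof
  assume "hom_part n p = p"
  then show "Poly_Mapping.keys p \<subseteq> {w. word_degree w = n}"
    using keys_hom_part[of n p] by auto
next
  assume "Poly_Mapping.keys p \<subseteq> {w. word_degree w = n}"
  then show "hom_part n p = p"
    by (intro poly_mapping_eqI) (auto simp: lookup_hom_part when_def in_keys_iff)
qed

lemma hom_part_mult:
  assumes "hom_part m p = p" "hom_part n q = q"
  shows "hom_part (m + n) (p * q) = p * q"
  using assms keys_mult[of p q] unfolding hom_part_eq_self_iff by fastforce

lemma hom_part_single_mult:
  "hom_part n (Poly_Mapping.single w c * p) = Poly_Mapping.single w c * hom_part (n - word_degree w) p"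
  using subset_UNIV[of "Poly_Mapping.keys p"]
  by (induction p rule: poly_mapping_monomial_induct)
    (auto simp: distrib_left mult_single hom_part_single)

lemma hom_part_mult_single:
  "hom_part n (p * Poly_Mapping.single w c) = hom_part (n - word_degree w) p * Poly_Mapping.single w c"
  using subset_UNIV[of "Poly_Mapping.keys p"]
  by (induction p rule: poly_mapping_monomial_induct)
    (auto simp: distrib_right mult_single hom_part_single)

section \<open>Congruence modulo the defining relations\<close>

lemma lpa_relations_carrier:
  assumes "wf_digraph G"
  shows "lpa_relations G \<subseteq> carrier (free_algebra (lpa_gens G))"
proof
  interpret wf_digraph G by (rule assms)
  fix r :: "('a, 'b, 'c::field) lpa_free"
  assume "r \<in> lpa_relations G"
  then show "r \<in> carrier (free_algebra (lpa_gens G))"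
    by cases (auto intro!: free_carrier_intros simp: lpa_gens_def)
qed

lemma lpa_relations_homogeneous:
  assumes "r \<in> lpa_relations G"
  shows "\<exists>n. hom_part n r = r"
  using assms
proof cases
  case (source_edge e)
  then show ?thesis by (auto simp: word_elem_def hom_part_single word_degree_def intro!: exI[of _ 1])
next
  case (edge_range e)
  then show ?thesis by (auto simp: word_elem_def hom_part_single word_degree_def intro!: exI[of _ 1])
next
  case (range_ghost e)
  then show ?thesis by (auto simp: word_elem_def hom_part_single word_degree_def intro!: exI[of _ "-1"])
next
  case (ghost_source e)
  then show ?thesis by (auto simp: word_elem_def hom_part_single word_degree_def intro!: exI[of _ "-1"])
qed (auto simp: word_elem_def hom_part_single word_degree_def intro!: exI[of _ 0])

context wf_digraph
begin

abbreviation lpa_carrier :: "('a, 'b, 'k::field) lpa_free set" where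
  "lpa_carrier \<equiv> carrier (free_algebra (lpa_gens G))"

lemma kernel_ideal: "alg_ideal (free_algebra (lpa_gens G)) (lpa_kernel G :: ('a, 'b, 'k::field) lpa_free set)"
  unfolding lpa_kernel_def by (intro alg_ideal_generated_ideal lpa_relations_carrier wf_digraph_axioms)

lemma kernel_carrier: "p \<in> lpa_kernel G \<Longrightarrow> p \<in> lpa_carrier"
  using kernel_ideal by (auto simp: alg_ideal_def)

lemma kernel_zero: "0 \<in> lpa_kernel G"
  using kernel_ideal by (auto simp: alg_ideal_def)

lemma kernel_add: "p \<in> lpa_kernel G \<Longrightarrow> q \<in> lpa_kernel G \<Longrightarrow> p + q \<in> lpa_kernel G"
  using kernel_ideal by (auto simp: alg_ideal_def)

lemma kernel_scale: "p \<in> lpa_kernel G \<Longrightarrow> Poly_Mapping.single 0 c * p \<in> lpa_kernel G"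
  using kernel_ideal by (auto simp: alg_ideal_def)

lemma kernel_mult_left: "p \<in> lpa_kernel G \<Longrightarrow> a \<in> lpa_carrier \<Longrightarrow> a * p \<in> lpa_kernel G"
  using kernel_ideal by (auto simp: alg_ideal_def)

lemma kernel_mult_right: "p \<in> lpa_kernel G \<Longrightarrow> a \<in> lpa_carrier \<Longrightarrow> p * a \<in> lpa_kernel G"
  using kernel_ideal by (auto simp: alg_ideal_def)

lemma kernel_uminus: "p \<in> lpa_kernel G \<Longrightarrow> - p \<in> lpa_kernel G"
  using kernel_scale[of p "-1"] by (simp only: scale_neg_one)

lemma kernel_sum: "(\<And>i. i \<in> S \<Longrightarrow> f i \<in> lpa_kernel G) \<Longrightarrow> sum f S \<in> lpa_kernel G"
  by (induction S rule: infinite_finite_induct) (auto simp: kernel_zero kernel_add)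

text \<open>An ideal with homogeneous generators is graded. As the kernel is the least ideal
  containing the relations, it suffices that the elements all of whose parts lie in the kernel form
  such an ideal.\<close>

lemma kernel_hom_part:
  fixes p :: "('a, 'b, 'k::field) lpa_free"
  assumes "p \<in> lpa_kernel G"
  shows "hom_part n p \<in> lpa_kernel G"
proof -
  let ?J = "{p \<in> lpa_kernel G. \<forall>n. hom_part n p \<in> lpa_kernel G} :: ('a, 'b, 'k) lpa_free set"
  have mult: "a * p \<in> ?J \<and> p * a \<in> ?J" if "a \<in> lpa_carrier" "p \<in> ?J" for a p
  proof -
    \<comment> \<open>Multiplication by a monomial merely shifts degrees, so the claim is reduced to
      monomials \<open>a\<close>.\<close>
    have "hom_part n (a * p) \<in> lpa_kernel G \<and> hom_part n (p * a) \<in> lpa_kernel G" for n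
      using that(1) unfolding mem_carrier_free_algebra
    proof (induction a rule: poly_mapping_monomial_induct)
      case (single w c)
      then have "Poly_Mapping.single w c \<in> (lpa_carrier :: ('a, 'b, 'k) lpa_free set)"
        by (simp add: free_carrier_single)
      then show ?case
        unfolding hom_part_single_mult hom_part_mult_single
        using that(2) by (auto intro: kernel_mult_left kernel_mult_right)
    qed (simp_all add: kernel_zero kernel_add distrib_left distrib_right)
    moreover have "a * p \<in> lpa_kernel G" "p * a \<in> lpa_kernel G"
      using that kernel_mult_left kernel_mult_right by auto
    ultimately show ?thesis by simp
  qed
  have "alg_ideal (free_algebra (lpa_gens G)) ?J"
    unfolding alg_ideal_def free_algebra_simps
  proof (intro conjI ballI allI)
    show "?J \<subseteq> lpa_carrier" using kernel_carrier by blast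
    show "0 \<in> ?J" by (simp add: kernel_zero)
    show "p + q \<in> ?J" if "p \<in> ?J" "q \<in> ?J" for p q using that by (simp add: kernel_add)
    show "Poly_Mapping.single 0 c * p \<in> ?J" if "p \<in> ?J" for c p
      using that by (simp add: kernel_scale hom_part_single_mult)
    show "a * p \<in> ?J" "p * a \<in> ?J" if "a \<in> lpa_carrier" "p \<in> ?J" for a p
      using mult[OF that] by (rule conjunct1) (use mult[OF that] in \<open>rule conjunct2\<close>)
  qed
  moreover have "lpa_relations G \<subseteq> ?J"
  proof
    fix r :: "('a, 'b, 'k) lpa_free"
    assume r: "r \<in> lpa_relations G"
    have "r \<in> lpa_kernel G"
      unfolding lpa_kernel_def using alg_ideal_generated_superset r by (rule subsetD)
    moreover obtain m where m: "hom_part m r = r"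
      using lpa_relations_homogeneous[OF r] by blast
    then have "hom_part n r = (if n = m then r else 0)" for n
      using hom_part_hom_part[of n m r] by simp
    ultimately show "r \<in> ?J"
      by (auto simp: kernel_zero)
  qed
  ultimately have "alg_ideal_generated (free_algebra (lpa_gens G)) (lpa_relations G) \<subseteq> ?J"
    by (rule alg_ideal_generated_subset)
  then have "lpa_kernel G \<subseteq> ?J"
    by (simp only: lpa_kernel_def)
  then show ?thesis
    using assms by blast
qed

end

section \<open>Vertices are nonzero\<close>

text \<open>
  Since the graph is countable, the arcs leaving a vertex \<open>v\<close> that is not a sink can be encoded
  by a bijection between \<open>out_arcs G v \<times> \<nat>\<close> and \<open>\<nat>\<close>. Functions on \<open>V \<times> \<nat>\<close> thereby
  become a module over the Leavitt path algebra on which every vertex acts nontrivially.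
\<close>

locale arc_coding = wf_digraph G for G :: "('v, 'e) pre_digraph" +
  fixes dec :: "'v \<Rightarrow> nat \<Rightarrow> 'e \<times> nat"
  assumes dec: "\<And>v. out_arcs G v \<noteq> {} \<Longrightarrow> bij_betw (dec v) UNIV (out_arcs G v \<times> UNIV)"
begin

definition enc :: "'e \<Rightarrow> nat \<Rightarrow> nat" where
  "enc e n = inv_into UNIV (dec (tail G e)) (e, n)"

lemma dec_enc: "e \<in> arcs G \<Longrightarrow> dec (tail G e) (enc e n) = (e, n)"
  unfolding enc_def using dec[of "tail G e"] by (intro bij_betw_inv_into_right) (auto simp: out_arcs_def)

lemma enc_dec:
  assumes "out_arcs G v \<noteq> {}" "dec v m = (e, n)"
  shows "e \<in> arcs G" "tail G e = v" "enc e n = m"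
proof -
  have "dec v m \<in> out_arcs G v \<times> UNIV"
    using dec[OF assms(1)] by (auto simp: bij_betw_def)
  then show e: "e \<in> arcs G" "tail G e = v"
    using assms(2) by auto
  show "enc e n = m"
    unfolding enc_def e(2) using bij_betw_inv_into_left[OF dec[OF assms(1)], of m] assms(2) by simp
qed

text \<open>The fibre over a vertex that is not a sink is the disjoint union of copies of the fibres
  over \<open>head G e\<close>, one for each outgoing arc \<open>e\<close>. \<open>Edge e\<close>
  moves a function from the fibre over \<open>head G e\<close> onto copy \<open>e\<close> and
  extends it by 0; \<open>Ghost e\<close> restricts to copy \<open>e\<close> and moves back.\<close>

fun act_letter :: "('v, 'e) lpa_gen \<Rightarrow> ('v \<times> nat \<Rightarrow> 'k::field) \<Rightarrow> 'v \<times> nat \<Rightarrow> 'k" where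
  "act_letter (Vert v) f x = (if fst x = v then f x else 0)"
| "act_letter (Edge e) f x =
    (if fst x = tail G e \<and> fst (dec (fst x) (snd x)) = e then f (head G e, snd (dec (fst x) (snd x))) else 0)"
| "act_letter (Ghost e) f x = (if fst x = head G e then f (tail G e, enc e (snd x)) else 0)"

definition act_word :: "('v, 'e) lpa_gen word \<Rightarrow> ('v \<times> nat \<Rightarrow> 'k::field) \<Rightarrow> 'v \<times> nat \<Rightarrow> 'k" where
  "act_word w = foldr act_letter (letters w)"

definition act :: "('v, 'e, 'k::field) lpa_free \<Rightarrow> ('v \<times> nat \<Rightarrow> 'k) \<Rightarrow> 'v \<times> nat \<Rightarrow> 'k" where
  "act p f x = (\<Sum>w\<in>Poly_Mapping.keys p. Poly_Mapping.lookup p w * act_word w f x)"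

lemma act_word_plus: "act_word (u + w) f = act_word u (act_word w f)"
  by (simp add: act_word_def)

lemma act_superset:
  assumes "finite S" "Poly_Mapping.keys p \<subseteq> S"
  shows "act p f x = (\<Sum>w\<in>S. Poly_Mapping.lookup p w * act_word w f x)"
  unfolding act_def using assms by (intro sum.mono_neutral_left) (auto simp: in_keys_iff)

lemma act_zero [simp]: "act 0 f x = 0"
  by (simp add: act_def)

lemma act_add [simp]: "act (p + q) f x = act p f x + act q f x"
proof -
  let ?S = "Poly_Mapping.keys p \<union> Poly_Mapping.keys q"
  show ?thesis
    using keys_add[of p q] act_superset[of ?S p f x] act_superset[of ?S q f x]
      act_superset[of ?S "p + q" f x]
    by (simp add: lookup_add distrib_right sum.distrib)
qed

lemma act_single [simp]: "act (Poly_Mapping.single w c) f x = c * act_word w f x"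
  by (simp add: act_def)

lemma act_word_elem [simp]: "act (word_elem xs) f x = act_word (Word xs) f x"
  by (simp add: word_elem_def)

lemma act_uminus [simp]: "act (- p) f x = - act p f x"
  using act_add[of p "- p" f x] by (simp add: eq_neg_iff_add_eq_0 add.commute)

lemma act_diff [simp]: "act (p - q) f x = act p f x - act q f x"
  using act_add[of p "- q" f x] by simp

lemma act_sum [simp]: "act (sum p S) f x = (\<Sum>i\<in>S. act (p i) f x)"
  by (induction S rule: infinite_finite_induct) auto

lemma act_letter_add: "act_letter l (\<lambda>x. f x + g x) x = act_letter l f x + act_letter l g x"
  by (cases l) auto

lemma act_letter_scale: "act_letter l (\<lambda>x. c * f x) x = c * act_letter l f x"
  by (cases l) auto

lemma act_word_add: "act_word w (\<lambda>x. f x + g x) x = act_word w f x + act_word w g x"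
proof -
  have "foldr act_letter ls (\<lambda>x. f x + g x) = (\<lambda>x. foldr act_letter ls f x + foldr act_letter ls g x)"
    for ls by (induction ls) (auto simp: act_letter_add)
  then show ?thesis
    by (simp add: act_word_def)
qed

lemma act_word_scale: "act_word w (\<lambda>x. c * f x) x = c * act_word w f x"
proof -
  have "foldr act_letter ls (\<lambda>x. c * f x) = (\<lambda>x. c * foldr act_letter ls f x)"
    for ls by (induction ls) (auto simp: act_letter_scale)
  then show ?thesis
    by (simp add: act_word_def)
qed

lemma act_word_zero: "act_word w (\<lambda>x. 0) = (\<lambda>x. 0 :: 'k::field)"
  using act_word_scale[of w "0::'k" "\<lambda>x. 0"] by (simp add: fun_eq_iff)

lemma act_mult: "act (p * q) f = act p (act q f)"
proof
  fix x
  have single: "act (Poly_Mapping.single w c * q) f x = c * act_word w (act q f) x" for w c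
    using subset_UNIV[of "Poly_Mapping.keys q"]
  proof (induction q rule: poly_mapping_monomial_induct)
    case zero
    have "act 0 f = (\<lambda>x. 0)" by auto
    then show ?case by (simp add: act_word_zero)
  next
    case (add p q)
    have "act (p + q) f = (\<lambda>x. act p f x + act q f x)" by auto
    then show ?case using add by (simp add: act_word_add distrib_left)
  next
    case (single u d)
    have "act (Poly_Mapping.single u d) f = (\<lambda>x. d * act_word u f x)" by auto
    then show ?case by (simp add: act_word_scale mult_single act_word_plus)
  qed
  show "act (p * q) f x = act p (act q f) x"
    using subset_UNIV[of "Poly_Mapping.keys p"]
    by (induction p rule: poly_mapping_monomial_induct) (simp_all add: distrib_right single)
qed

lemma act_relation:
  assumes "r \<in> lpa_relations G"
  shows "act r f x = 0"
  using assms
proof cases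
  case (regular_vert v)
  show ?thesis
  proof (cases "fst x = v")
    case True
    \<comment> \<open>The point \<open>x\<close> lies in the copy of exactly one arc
      \<open>e\<close>, so only the summand of \<open>e\<close> can be nonzero at
      \<open>x\<close>.\<close>
    obtain e n where en: "dec v (snd x) = (e, n)" by fastforce
    note e = enc_dec[OF regular_vert(3) en]
    have "(\<Sum>e'\<in>out_arcs G v. act_word (Word [Edge e', Ghost e']) f x) =
        (\<Sum>e'\<in>out_arcs G v. if e' = e then f x else 0)"
      using True en e by (intro sum.cong) (auto simp: act_word_def)
    then show ?thesis
      using e True regular_vert by (simp add: act_word_def)
  next
    case False
    then have "(\<Sum>e'\<in>out_arcs G v. act_word (Word [Edge e', Ghost e']) f x) = 0"
      by (intro sum.neutral) (auto simp: act_word_def)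
    then show ?thesis
      using False regular_vert by (simp add: act_word_def)
  qed
qed (cases x; auto simp: act_word_def dec_enc)+

lemma act_kernel:
  fixes p :: "('v, 'e, 'k::field) lpa_free"
  assumes "p \<in> lpa_kernel G"
  shows "act p f = (\<lambda>x. 0)"
proof -
  \<comment> \<open>Quantifying over all \<open>f\<close> gives closure under right factors, because
    \<open>act (p * a) f = act p (act a f)\<close>.\<close>
  let ?J = "{p \<in> lpa_carrier. \<forall>f. act p f = (\<lambda>x. 0)} :: ('v, 'e, 'k) lpa_free set"
  have zero: "act a (\<lambda>x. 0) = (\<lambda>x. 0 :: 'k)" for a
    by (auto simp: act_def act_word_zero)
  have "alg_ideal (free_algebra (lpa_gens G)) ?J"
    unfolding alg_ideal_def by (simp add: act_mult zero act_add[abs_def] act_zero[abs_def] free_carrier_intros)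
  moreover have "lpa_relations G \<subseteq> ?J"
    using lpa_relations_carrier[OF wf_digraph_axioms] by (auto simp: act_relation)
  ultimately have "alg_ideal_generated (free_algebra (lpa_gens G)) (lpa_relations G) \<subseteq> ?J"
    by (rule alg_ideal_generated_subset)
  then have "lpa_kernel G \<subseteq> ?J"
    by (simp only: lpa_kernel_def)
  then show ?thesis
    using assms by blast
qed

end

context wf_digraph
begin

lemma vertex_notin_kernel:
  assumes "countable (arcs G)" "c \<noteq> (0 :: 'k::field)"
  shows "Poly_Mapping.single (Word [Vert v]) c \<notin> lpa_kernel G"
proof
  assume v: "Poly_Mapping.single (Word [Vert v]) c \<in> lpa_kernel G"
  \<comment> \<open>The factor \<open>\<nat>\<close> makes the product infinite even if only
    finitely many arcs leave \<open>u\<close>.\<close>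
  have "\<exists>d :: nat \<Rightarrow> 'b \<times> nat. bij_betw d UNIV (out_arcs G u \<times> UNIV)" if "out_arcs G u \<noteq> {}" for u
  proof -
    have "countable (out_arcs G u)"
      using assms(1) by (rule countable_subset[rotated]) auto
    then have "countable (out_arcs G u \<times> (UNIV :: nat set))" by simp
    moreover have "infinite (out_arcs G u \<times> (UNIV :: nat set))"
      using that by (simp add: finite_cartesian_product_iff)
    ultimately show ?thesis
      using bij_betw_from_nat_into by blast
  qed
  then obtain dec :: "'a \<Rightarrow> nat \<Rightarrow> 'b \<times> nat" where
    "\<And>u. out_arcs G u \<noteq> {} \<Longrightarrow> bij_betw (dec u) UNIV (out_arcs G u \<times> UNIV)"
    by metis
  then interpret arc_coding G dec
    by unfold_locales
  \<comment> \<open>The vertex turns the constant function 1 into the indicator of its fibre, so the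
    value here is also \<open>c\<close>.\<close>
  have "act (Poly_Mapping.single (Word [Vert v]) c) (\<lambda>x. 1) (v, 0) = 0"
    using act_kernel[OF v] by simp
  then show False
    using assms(2) by (simp add: act_word_def)
qed

end

section \<open>Normal forms of words\<close>

text \<open>The parameter \<open>scalars\<close> only serves to fix the type of scalars.\<close>

locale leavitt = wf_digraph G for G :: "('a, 'b) pre_digraph" +
  fixes scalars :: "'k::field itself"
begin

section \<open>Calculus of the congruence modulo the kernel\<close>

definition lpa_eq :: "('a, 'b, 'k) lpa_free \<Rightarrow> ('a, 'b, 'k) lpa_free \<Rightarrow> bool" (infix "\<approx>" 50) where
  "p \<approx> q \<longleftrightarrow> p - q \<in> lpa_kernel G"

lemma lpa_eq_refl [simp]: "p \<approx> p"
  by (simp add: lpa_eq_def kernel_zero)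

lemma lpa_eq_sym: "p \<approx> q \<Longrightarrow> q \<approx> p"
  unfolding lpa_eq_def using kernel_uminus by fastforce

lemma lpa_eq_trans [trans]: "p \<approx> q \<Longrightarrow> q \<approx> r \<Longrightarrow> p \<approx> r"
  unfolding lpa_eq_def using kernel_add by fastforce

lemma lpa_eq_add: "p \<approx> q \<Longrightarrow> p' \<approx> q' \<Longrightarrow> p + p' \<approx> q + q'"
  unfolding lpa_eq_def by (metis kernel_add add_diff_add)

lemma lpa_eq_scale: "p \<approx> q \<Longrightarrow> Poly_Mapping.single 0 c * p \<approx> Poly_Mapping.single 0 c * q"
  unfolding lpa_eq_def using kernel_scale by (metis right_diff_distrib)

lemma lpa_eq_mult_left: "p \<approx> q \<Longrightarrow> a \<in> lpa_carrier \<Longrightarrow> a * p \<approx> a * q"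
  unfolding lpa_eq_def using kernel_mult_left by (metis right_diff_distrib)

lemma lpa_eq_mult_right: "p \<approx> q \<Longrightarrow> a \<in> lpa_carrier \<Longrightarrow> p * a \<approx> q * a"
  unfolding lpa_eq_def using kernel_mult_right by (metis left_diff_distrib)

lemma lpa_eq_sum: "(\<And>i. i \<in> S \<Longrightarrow> f i \<approx> g i) \<Longrightarrow> sum f S \<approx> sum g S"
  by (induction S rule: infinite_finite_induct) (auto intro: lpa_eq_add)

lemma lpa_eq_0_iff: "p \<approx> 0 \<longleftrightarrow> p \<in> lpa_kernel G"
  by (simp add: lpa_eq_def)

lemma lpa_eq_0_mult_left: "p \<approx> 0 \<Longrightarrow> a \<in> lpa_carrier \<Longrightarrow> a * p \<approx> 0"
  by (simp add: lpa_eq_0_iff kernel_mult_left)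

lemma lpa_eq_0_mult_right: "p \<approx> 0 \<Longrightarrow> a \<in> lpa_carrier \<Longrightarrow> p * a \<approx> 0"
  by (simp add: lpa_eq_0_iff kernel_mult_right)

lemma lpa_eq_0_scale: "p \<approx> 0 \<Longrightarrow> Poly_Mapping.single 0 c * p \<approx> 0"
  by (simp add: lpa_eq_0_iff kernel_scale)

lemma lpa_eq_0_sum: "(\<And>i. i \<in> S \<Longrightarrow> f i \<approx> 0) \<Longrightarrow> sum f S \<approx> 0"
  by (simp add: lpa_eq_0_iff kernel_sum)

lemma single_eq:
  "word_elem xs \<approx> word_elem ys \<Longrightarrow> Poly_Mapping.single (Word xs) c \<approx> Poly_Mapping.single (Word ys) c"
  by (subst (1 2) single_Word) (rule lpa_eq_scale)

lemma single_eq_0: "word_elem xs \<approx> 0 \<Longrightarrow> Poly_Mapping.single (Word xs) c \<approx> 0"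
  by (subst single_Word) (rule lpa_eq_0_scale)

lemma relation_eq: "p - q \<in> lpa_relations G \<Longrightarrow> p \<approx> q"
  unfolding lpa_eq_def lpa_kernel_def using alg_ideal_generated_superset by (rule subsetD)

lemma relation_eq_0: "p \<in> lpa_relations G \<Longrightarrow> p \<approx> 0"
  using relation_eq[of p 0] by simp

text \<open>The unit \<open>word_elem []\<close> of the ambient ring lies outside the carrier, so
  absorption by the ideal does not cover empty contexts; they are split off.\<close>

lemma word_elem_mult_kernel:
  assumes "p \<in> lpa_kernel G" "set xs \<subseteq> lpa_gens G" "set ys \<subseteq> lpa_gens G"
  shows "word_elem xs * p * word_elem ys \<in> lpa_kernel G"
proof -
  have one: "word_elem [] = 1"
    by (simp add: word_elem_def flip: zero_word_def)
  have "word_elem xs * p \<in> lpa_kernel G"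
    using assms by (cases "xs = []") (simp_all add: one kernel_mult_left free_carrier_word_elem)
  then show ?thesis
    using assms by (cases "ys = []") (simp_all add: one kernel_mult_right free_carrier_word_elem)
qed

lemma word_eq_context:
  assumes "word_elem us \<approx> word_elem vs" "set xs \<subseteq> lpa_gens G" "set ys \<subseteq> lpa_gens G"
  shows "word_elem (xs @ us @ ys) \<approx> word_elem (xs @ vs @ ys)"
  using word_elem_mult_kernel[OF assms[unfolded lpa_eq_def]]
  by (simp add: lpa_eq_def left_diff_distrib right_diff_distrib word_elem_mult)

lemma word_eq_0_context:
  assumes "word_elem us \<approx> 0" "set xs \<subseteq> lpa_gens G" "set ys \<subseteq> lpa_gens G"
  shows "word_elem (xs @ us @ ys) \<approx> 0"
  using word_elem_mult_kernel[OF assms[unfolded lpa_eq_0_iff]]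
  by (simp add: lpa_eq_0_iff word_elem_mult)

section \<open>Sources and ranges of generators\<close>

fun letter_source :: "('a, 'b) lpa_gen \<Rightarrow> 'a" where
  "letter_source (Vert v) = v"
| "letter_source (Edge e) = tail G e"
| "letter_source (Ghost e) = head G e"

fun letter_range :: "('a, 'b) lpa_gen \<Rightarrow> 'a" where
  "letter_range (Vert v) = v"
| "letter_range (Edge e) = head G e"
| "letter_range (Ghost e) = tail G e"

lemma gens_iff [simp]:
  "Vert v \<in> lpa_gens G \<longleftrightarrow> v \<in> verts G"
  "Edge e \<in> lpa_gens G \<longleftrightarrow> e \<in> arcs G"
  "Ghost e \<in> lpa_gens G \<longleftrightarrow> e \<in> arcs G"
  by (auto simp: lpa_gens_def)

lemma letter_ends_verts:
  "l \<in> lpa_gens G \<Longrightarrow> letter_source l \<in> verts G"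
  "l \<in> lpa_gens G \<Longrightarrow> letter_range l \<in> verts G"
  by (cases l; simp)+

lemma letter_range_unit:
  assumes "l \<in> lpa_gens G"
  shows "word_elem [l, Vert (letter_range l)] \<approx> word_elem [l]"
  using assms by (cases l) (auto intro!: relation_eq lpa_relations.intros)

lemma letter_source_unit:
  assumes "l \<in> lpa_gens G"
  shows "word_elem [Vert (letter_source l), l] \<approx> word_elem [l]"
  using assms by (cases l) (auto intro!: relation_eq lpa_relations.intros)

text \<open>Inserting the range gives \<open>l v = l r(l) v\<close>, and distinct vertices are
  orthogonal.\<close>

lemma letter_range_mismatch:
  assumes "l \<in> lpa_gens G" "v \<in> verts G" "v \<noteq> letter_range l"
  shows "word_elem [l, Vert v] \<approx> 0"
proof -
  have "word_elem [l, Vert v] \<approx> word_elem [l, Vert (letter_range l), Vert v]"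
    using word_eq_context[THEN lpa_eq_sym, OF letter_range_unit[OF assms(1)], of "[]" "[Vert v]"] assms
    by simp
  also have "\<dots> \<approx> 0"
  proof -
    have "word_elem [Vert (letter_range l), Vert v] \<approx> 0"
      using assms letter_ends_verts by (intro relation_eq_0 lpa_relations.vert_orth) auto
    from word_eq_0_context[OF this, of "[l]" "[]"] show ?thesis
      using assms by simp
  qed
  finally show ?thesis .
qed

lemma letters_mismatch:
  assumes "l \<in> lpa_gens G" "l' \<in> lpa_gens G" "letter_range l \<noteq> letter_source l'"
  shows "word_elem [l, l'] \<approx> 0"
proof -
  have "word_elem [l, l'] \<approx> word_elem [l, Vert (letter_source l'), l']"
    using word_eq_context[THEN lpa_eq_sym, OF letter_source_unit[OF assms(2)], of "[l]" "[]"] assms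
    by simp
  also have "\<dots> \<approx> 0"
    using word_eq_0_context[OF letter_range_mismatch[of l "letter_source l'"], of "[]" "[l']"]
      assms letter_ends_verts by auto
  finally show ?thesis .
qed

lemma word_mult_mismatch:
  assumes "set xs \<subseteq> lpa_gens G" "xs \<noteq> []" "l \<in> lpa_gens G" "letter_range (last xs) \<noteq> letter_source l"
  shows "word_elem (xs @ [l]) \<approx> 0"
proof -
  have "last xs \<in> lpa_gens G" "set (butlast xs) \<subseteq> lpa_gens G"
    using assms by (auto dest: in_set_butlastD)
  then show ?thesis
    using word_eq_0_context[OF letters_mismatch[of "last xs" l], of "butlast xs" "[]"] assms
    by (metis append.assoc append_Cons append_Nil append_Nil2 append_butlast_last_id empty_set empty_subsetI)
qed

lemma word_mult_vertex:
  assumes "set xs \<subseteq> lpa_gens G" "xs \<noteq> []"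
  shows "word_elem (xs @ [Vert (letter_range (last xs))]) \<approx> word_elem xs"
proof -
  have "last xs \<in> lpa_gens G" "set (butlast xs) \<subseteq> lpa_gens G"
    using assms by (auto dest: in_set_butlastD)
  then show ?thesis
    using word_eq_context[OF letter_range_unit[of "last xs"], of "butlast xs" "[]"] assms
    by (metis append.assoc append_Cons append_Nil append_Nil2 append_butlast_last_id empty_set empty_subsetI)
qed

text \<open>
  The word \<open>path_ghost_word p v q\<close> represents \<open>\<alpha>\<beta>\<^sup>*\<close> for the paths \<open>\<alpha>\<close> and \<open>\<beta>\<close> with edges
  \<open>p\<close> and \<open>q\<close> and common range \<open>v\<close>. The redundant letter in the middle makes trivial paths a
  special case rather than an exception.
\<close>

definition path_ghost_word :: "'b list \<Rightarrow> 'a \<Rightarrow> 'b list \<Rightarrow> ('a, 'b) lpa_gen list" where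
  "path_ghost_word p v q = map Edge p @ [Vert v] @ map Ghost (rev q)"

lemma path_ghost_word_nonempty [simp]: "path_ghost_word p v q \<noteq> []"
  by (simp add: path_ghost_word_def)

lemma path_ghost_word_gens:
  "awalk a p v \<Longrightarrow> awalk b q v \<Longrightarrow> set (path_ghost_word p v q) \<subseteq> lpa_gens G"
  using awalk_last_in_verts[of a p v] by (auto simp: path_ghost_word_def awalk_def)

lemma word_degree_path_ghost:
  "word_degree (Word (path_ghost_word p v q)) = int (length p) - int (length q)"
proof -
  have "sum_list (map letter_degree (map Edge p :: ('a, 'b) lpa_gen list)) = int (length p)" by (induction p) auto
  moreover have "sum_list (map letter_degree (map Ghost (rev q) :: ('a, 'b) lpa_gen list)) = - int (length q)" by (induction q) auto
  ultimately show ?thesis by (simp add: word_degree_def path_ghost_word_def)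
qed

lemma letter_range_path_ghost:
  "awalk b q v \<Longrightarrow> letter_range (last (path_ghost_word p v q)) = b"
  by (cases q) (auto simp: path_ghost_word_def awalk_def)

section \<open>Right multiplication of \<open>\<alpha>\<beta>\<^sup>*\<close> by a generator\<close>

lemma path_ghost_mult_vertex:
  assumes "awalk a p v" "awalk b q v"
  shows "word_elem (path_ghost_word p v q @ [Vert b]) \<approx> word_elem (path_ghost_word p v q)"
  using word_mult_vertex[OF path_ghost_word_gens[OF assms] path_ghost_word_nonempty]
  by (simp add: letter_range_path_ghost[OF assms(2)])

lemma path_ghost_mult_mismatch:
  assumes "awalk a p v" "awalk b q v" "l \<in> lpa_gens G" "letter_source l \<noteq> b"
  shows "word_elem (path_ghost_word p v q @ [l]) \<approx> 0"
  using word_mult_mismatch[OF path_ghost_word_gens[OF assms(1,2)] path_ghost_word_nonempty assms(3)] assms(4)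
  by (simp add: letter_range_path_ghost[OF assms(2)])

lemma path_mult_edge:
  assumes "awalk a p v" "g \<in> arcs G" "tail G g = v"
  shows "word_elem (path_ghost_word p v [] @ [Edge g]) \<approx> word_elem (path_ghost_word (p @ [g]) (head G g) [])"
proof -
  have p: "set (map Edge p) \<subseteq> lpa_gens G"
    using assms by (auto simp: awalk_def)
  have "word_elem (map Edge p @ [Vert v, Edge g]) \<approx> word_elem (map Edge p @ [Edge g])"
    using word_eq_context[OF letter_source_unit[of "Edge g"] p, of "[]"] assms by simp
  also have "\<dots> \<approx> word_elem (map Edge p @ [Edge g, Vert (head G g)])"
    using word_eq_context[THEN lpa_eq_sym, OF letter_range_unit[of "Edge g"] p, of "[]"] assms by simp
  finally show ?thesis
    by (simp add: path_ghost_word_def)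
qed

text \<open>The ghost part is reversed, so the first edge \<open>f\<close> of \<open>\<beta>\<close>
  supplies the last letter. It meets the new edge, and \<open>f\<^sup>* f\<close> collapses to a
  vertex that the remaining word absorbs.\<close>

lemma path_ghost_mult_edge:
  assumes "awalk a p v" "awalk b (f # q) v"
  shows "word_elem (path_ghost_word p v (f # q) @ [Edge f]) \<approx> word_elem (path_ghost_word p v q)"
proof -
  have q: "awalk (head G f) q v" "f \<in> arcs G"
    using assms(2) by (auto simp: awalk_Cons_iff)
  have "word_elem (path_ghost_word p v (f # q) @ [Edge f]) =
      word_elem (path_ghost_word p v q @ [Ghost f, Edge f])"
    by (simp add: path_ghost_word_def)
  also have "\<dots> \<approx> word_elem (path_ghost_word p v q @ [Vert (head G f)])"
    using word_eq_context[OF relation_eq[OF ghost_edge_same[OF q(2)]] path_ghost_word_gens[OF assms(1) q(1)], of "[]"]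
    by simp
  also have "\<dots> \<approx> word_elem (path_ghost_word p v q)"
    by (rule path_ghost_mult_vertex[OF assms(1) q(1)])
  finally show ?thesis .
qed

lemma path_ghost_mult_other_edge:
  assumes "awalk a p v" "awalk b (f # q) v" "g \<in> arcs G" "g \<noteq> f"
  shows "word_elem (path_ghost_word p v (f # q) @ [Edge g]) \<approx> 0"
proof -
  have q: "awalk (head G f) q v" "f \<in> arcs G"
    using assms(2) by (auto simp: awalk_Cons_iff)
  have "word_elem (path_ghost_word p v (f # q) @ [Edge g]) =
      word_elem (path_ghost_word p v q @ [Ghost f, Edge g])"
    by (simp add: path_ghost_word_def)
  also have "\<dots> \<approx> 0"
    using word_eq_0_context[OF relation_eq_0[OF ghost_edge_diff[OF q(2) assms(3)]] path_ghost_word_gens[OF assms(1) q(1)], of "[]"]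
      assms(4) by simp
  finally show ?thesis .
qed

lemma path_ghost_mult_ghost:
  "path_ghost_word p v q @ [Ghost f] = path_ghost_word p v (f # q)"
  by (simp add: path_ghost_word_def)

text \<open>The bound \<open>M\<close> is the induction measure for the reduction to paths. For
  \<open>M = 0\<close> only paths of length exactly \<open>d\<close> remain.\<close>

definition path_ghost_words :: "nat \<Rightarrow> int \<Rightarrow> ('a, 'b) lpa_gen word set" where
  "path_ghost_words M d = {Word (path_ghost_word p v q) | a p v q b.
     awalk a p v \<and> awalk b q v \<and> length q \<le> M \<and> int (length p) - int (length q) = d}"

lemma path_ghost_wordsI:
  "awalk a p v \<Longrightarrow> awalk b q v \<Longrightarrow> length q \<le> M \<Longrightarrow> int (length p) - int (length q) = d \<Longrightarrow>
    Word (path_ghost_word p v q) \<in> path_ghost_words M d"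
  unfolding path_ghost_words_def by blast

lemma path_ghost_words_mono: "M \<le> M' \<Longrightarrow> path_ghost_words M d \<subseteq> path_ghost_words M' d"
  unfolding path_ghost_words_def by (blast intro: order_trans)

lemma path_ghost_words_cases:
  assumes "w \<in> path_ghost_words M d"
  obtains a p v q b where "w = Word (path_ghost_word p v q)" "awalk a p v" "awalk b q v"
    "length q \<le> M" "int (length p) - int (length q) = d"
  using assms unfolding path_ghost_words_def by blast

lemma path_ghost_words_carrier:
  assumes "Poly_Mapping.keys x \<subseteq> path_ghost_words M d"
  shows "x \<in> lpa_carrier"
proof -
  have "letters w \<noteq> [] \<and> set (letters w) \<subseteq> lpa_gens G" if "w \<in> path_ghost_words M d" for w
    using that by (elim path_ghost_words_cases) (simp add: path_ghost_word_gens)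
  then show ?thesis
    using assms unfolding mem_carrier_free_algebra by blast
qed

text \<open>Appending a letter to \<open>\<alpha>\<beta>\<^sup>*\<close> gives 0 or another word of
  this kind, so induction from the right end suffices. These words span but are not independent: a
  regular vertex \<open>v\<close> is congruent to the sum of the \<open>e e\<^sup>*\<close>.\<close>

lemma word_normal_form:
  assumes "xs \<noteq> []" "set xs \<subseteq> lpa_gens G"
  shows "word_elem xs \<approx> (0 :: ('a, 'b, 'k) lpa_free) \<or>
    (\<exists>a p v q b. awalk a p v \<and> awalk b q v \<and> word_degree (Word (path_ghost_word p v q)) = word_degree (Word xs) \<and>
      word_elem xs \<approx> (word_elem (path_ghost_word p v q) :: ('a, 'b, 'k) lpa_free))"
  using assms
proof (induction xs rule: rev_nonempty_induct)
  case (single l)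
  show ?case
  proof (cases l)
    case (Vert v)
    have "awalk v [] v" "word_elem [l] \<approx> word_elem (path_ghost_word [] v [])"
      using single by (simp_all add: Vert path_ghost_word_def awalk_Nil_iff)
    moreover have "word_degree (Word (path_ghost_word [] v [])) = word_degree (Word [l])"
      by (simp add: word_degree_path_ghost) (simp add: word_degree_def Vert)
    ultimately show ?thesis by blast
  next
    case (Edge e)
    then have e: "e \<in> arcs G" using single by simp
    then have "awalk (tail G e) [e] (head G e)" "awalk (head G e) [] (head G e)"
      by (auto simp: awalk_Cons_iff awalk_Nil_iff)
    moreover have "word_elem [l] \<approx> word_elem (path_ghost_word [e] (head G e) [])"
      using letter_range_unit[THEN lpa_eq_sym, of l] e by (simp add: path_ghost_word_def Edge)
    moreover have "word_degree (Word (path_ghost_word [e] (head G e) [])) = word_degree (Word [l])"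
      by (simp add: word_degree_path_ghost) (simp add: word_degree_def Edge)
    ultimately show ?thesis by blast
  next
    case (Ghost e)
    then have e: "e \<in> arcs G" using single by simp
    then have "awalk (tail G e) [e] (head G e)" "awalk (head G e) [] (head G e)"
      by (auto simp: awalk_Cons_iff awalk_Nil_iff)
    moreover have "word_elem [l] \<approx> word_elem (path_ghost_word [] (head G e) [e])"
      using letter_source_unit[THEN lpa_eq_sym, of l] e by (simp add: path_ghost_word_def Ghost)
    moreover have "word_degree (Word (path_ghost_word [] (head G e) [e])) = word_degree (Word [l])"
      by (simp add: word_degree_path_ghost) (simp add: word_degree_def Ghost)
    ultimately show ?thesis by blast
  qed
next
  case (snoc l xs)
  have l: "l \<in> lpa_gens G" and xs: "set xs \<subseteq> lpa_gens G"
    using snoc.prems by auto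
  have deg: "word_degree (Word (xs @ [l])) = word_degree (Word xs) + letter_degree l"
    by (simp add: word_degree_def)
  have witness: ?case if "awalk a p v" "awalk b q v"
      "int (length p) - int (length q) = word_degree (Word xs) + letter_degree l"
      "word_elem (xs @ [l]) \<approx> word_elem (path_ghost_word p v q)" for a p v q b
    using that by (intro disjI2 exI[of _ a] exI[of _ p] exI[of _ v] exI[of _ q] exI[of _ b])
      (simp add: deg word_degree_path_ghost)
  from snoc.IH[OF xs] show ?case
  proof (elim disjE exE conjE)
    assume "word_elem xs \<approx> (0 :: ('a, 'b, 'k) lpa_free)"
    from word_eq_0_context[OF this, of "[]" "[l]"] l show ?thesis by simp
  next
    fix a p v q b
    assume p: "awalk a p v" and q: "awalk b q v"
      and "word_degree (Word (path_ghost_word p v q)) = word_degree (Word xs)"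
      and eq: "word_elem xs \<approx> (word_elem (path_ghost_word p v q) :: ('a, 'b, 'k) lpa_free)"
    then have d: "int (length p) - int (length q) = word_degree (Word xs)"
      by (simp add: word_degree_path_ghost)
    have step: "word_elem (xs @ [l]) \<approx> (word_elem (path_ghost_word p v q @ [l]) :: ('a, 'b, 'k) lpa_free)"
      using word_eq_context[OF eq, of "[]" "[l]"] l by simp
    show ?thesis
    proof (cases "letter_source l = b")
      case False
      from lpa_eq_trans[OF step path_ghost_mult_mismatch[OF p q l False]] show ?thesis by blast
    next
      case b: True
      show ?thesis
      proof (cases l)
        case (Vert w)
        then have "word_elem (xs @ [l]) \<approx> (word_elem (path_ghost_word p v q) :: ('a, 'b, 'k) lpa_free)"
          using lpa_eq_trans[OF step] path_ghost_mult_vertex[OF p q] b by simp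
        then show ?thesis using p q d Vert by (intro witness) auto
      next
        case (Ghost f)
        then have fq: "awalk (tail G f) (f # q) v"
          using q b l by (simp add: awalk_Cons_iff)
        have eq: "word_elem (xs @ [l]) \<approx> word_elem (path_ghost_word p v (f # q))"
          using step by (simp add: Ghost path_ghost_mult_ghost)
        show ?thesis
          using d by (intro witness[OF p fq _ eq]) (simp add: Ghost)
      next
        case (Edge f)
        then have f: "f \<in> arcs G" using l by simp
        show ?thesis
        proof (cases q)
          case Nil
          then have v: "tail G f = v" using q b Edge by (simp add: awalk_Nil_iff)
          have "awalk a (p @ [f]) (head G f)" "awalk (head G f) [] (head G f)"
            using p f v by (auto simp: awalk_append_iff awalk_Cons_iff awalk_Nil_iff)
          moreover have "word_elem (xs @ [l]) \<approx> (word_elem (path_ghost_word (p @ [f]) (head G f) []) :: ('a, 'b, 'k) lpa_free)"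
            using lpa_eq_trans[OF step] path_mult_edge[OF p f v] Nil Edge by simp
          ultimately show ?thesis
            using d Edge Nil by (intro witness) auto
        next
          case (Cons g q')
          have q': "awalk (head G g) q' v" using q Cons by (simp add: awalk_Cons_iff)
          show ?thesis
          proof (cases "f = g")
            case True
            then have "word_elem (xs @ [l]) \<approx> (word_elem (path_ghost_word p v q') :: ('a, 'b, 'k) lpa_free)"
              using lpa_eq_trans[OF step] path_ghost_mult_edge[of a p v b f q'] p q Cons Edge by simp
            then show ?thesis
              using p q' d Edge Cons by (intro witness) auto
          next
            case False
            then have "word_elem (xs @ [l]) \<approx> (0 :: ('a, 'b, 'k) lpa_free)"
              using lpa_eq_trans[OF step] path_ghost_mult_other_edge[of a p v b g q' f] p q Cons Edge f by simp
            then show ?thesis by blast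
          qed
        qed
      qed
    qed
  qed
qed

section \<open>Graded semiprimeness\<close>

lemma normal_form:
  assumes "x \<in> lpa_carrier" "hom_part d x = x"
  obtains M x' where "Poly_Mapping.keys x' \<subseteq> path_ghost_words M d" "x \<approx> x'"
proof -
  have "Poly_Mapping.keys x \<subseteq> {w. letters w \<noteq> [] \<and> set (letters w) \<subseteq> lpa_gens G \<and> word_degree w = d}"
    using assms unfolding hom_part_eq_self_iff mem_carrier_free_algebra by blast
  then have "\<exists>M x'. Poly_Mapping.keys x' \<subseteq> path_ghost_words M d \<and> x \<approx> x'"
  proof (induction x rule: poly_mapping_monomial_induct)
    case zero
    show ?case by (intro exI[of _ 0] conjI) simp_all
  next
    case (add x y)
    then obtain M x' N y' where
      "Poly_Mapping.keys x' \<subseteq> path_ghost_words M d" "x \<approx> x'"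
      "Poly_Mapping.keys y' \<subseteq> path_ghost_words N d" "y \<approx> y'" by blast
    moreover have "path_ghost_words M d \<subseteq> path_ghost_words (max M N) d"
      "path_ghost_words N d \<subseteq> path_ghost_words (max M N) d"
      by (auto intro!: path_ghost_words_mono)
    ultimately show ?case
      using keys_add[of x' y'] lpa_eq_add[of x x' y y']
      by (intro exI[of _ "max M N"] exI[of _ "x' + y'"]) blast
  next
    case (single w c)
    obtain xs where w: "w = Word xs" by (cases w)
    have "word_elem xs \<approx> 0 \<or> (\<exists>a p v q b. awalk a p v \<and> awalk b q v \<and>
        word_degree (Word (path_ghost_word p v q)) = word_degree (Word xs) \<and>
        word_elem xs \<approx> word_elem (path_ghost_word p v q))"
      using single by (intro word_normal_form) (auto simp: w)
    then show ?case
    proof (elim disjE exE conjE)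
      assume "word_elem xs \<approx> 0"
      then show ?thesis
        using single_eq_0 w by (intro exI[of _ 0]) auto
    next
      fix a p v q b
      assume *: "awalk a p v" "awalk b q v" "word_elem xs \<approx> word_elem (path_ghost_word p v q)"
        "word_degree (Word (path_ghost_word p v q)) = word_degree (Word xs)"
      have "Word (path_ghost_word p v q) \<in> path_ghost_words (length q) d"
        using * single by (intro path_ghost_wordsI[of a p v b]) (auto simp: w word_degree_path_ghost)
      then show ?thesis
        using single_eq[OF *(3)] w
        by (intro exI[of _ "length q"] exI[of _ "Poly_Mapping.single (Word (path_ghost_word p v q)) c"])
          (auto split: if_splits)
    qed
  qed
  then show ?thesis using that by blast
qed

text \<open>A word absorbs the range of its last letter on the right and gives 0 with every other
  vertex, so the sum of these finitely many ranges is a right unit for \<open>x\<close>. The last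
  clause serves to find, for \<open>x\<close> not congruent to 0, a vertex \<open>w\<close> with
  \<open>x w\<close> not congruent to 0.\<close>

lemma local_right_unit:
  assumes "x \<in> lpa_carrier"
  obtains u where "u \<in> lpa_carrier" "x * u \<approx> x"
    "\<And>y. (\<And>w. w \<in> verts G \<Longrightarrow> y * word_elem [Vert w] \<approx> 0) \<Longrightarrow> y * u \<approx> 0"
proof -
  define W where "W = (\<lambda>w. letter_range (last (letters w))) ` Poly_Mapping.keys x"
  define u :: "('a, 'b, 'k) lpa_free" where "u = (\<Sum>v\<in>W. word_elem [Vert v])"
  have key: "letters w \<noteq> []" "set (letters w) \<subseteq> lpa_gens G" if "w \<in> Poly_Mapping.keys x" for w
    using that assms unfolding mem_carrier_free_algebra by auto
  have W: "W \<subseteq> verts G"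
    unfolding W_def using key letter_ends_verts(2) last_in_set by blast
  then have u: "u \<in> lpa_carrier"
    unfolding u_def by (intro free_carrier_sum free_carrier_word_elem) auto
  moreover have "x * u \<approx> x"
  proof -
    have "Poly_Mapping.single w c * u \<approx> Poly_Mapping.single w c" if w: "w \<in> Poly_Mapping.keys x" for w c
    proof -
      let ?r = "letter_range (last (letters w))"
      have fin: "finite W" "?r \<in> W"
        using w by (auto simp: W_def)
      have "(\<Sum>v\<in>W. word_elem (letters w @ [Vert v])) \<approx> (\<Sum>v\<in>W. if v = ?r then word_elem (letters w) else 0)"
      proof (rule lpa_eq_sum)
        fix v
        assume "v \<in> W"
        then have "v \<in> verts G" using W by blast
        then show "word_elem (letters w @ [Vert v]) \<approx> (if v = ?r then word_elem (letters w) else 0)"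
          using word_mult_vertex[OF key(2)[OF w] key(1)[OF w]]
            word_mult_mismatch[OF key(2)[OF w] key(1)[OF w], of "Vert v"] by auto
      qed
      also have "\<dots> = word_elem (letters w)"
        using fin by simp
      finally have "Poly_Mapping.single 0 c * (word_elem (letters w) * u) \<approx> Poly_Mapping.single 0 c * word_elem (letters w)"
        by (intro lpa_eq_scale) (simp add: u_def sum_distrib_left word_elem_mult)
      then show ?thesis
        using single_Word[of "letters w" c] by (simp add: mult.assoc)
    qed
    then have "(\<Sum>w\<in>Poly_Mapping.keys x. Poly_Mapping.single w (Poly_Mapping.lookup x w) * u) \<approx>
        (\<Sum>w\<in>Poly_Mapping.keys x. Poly_Mapping.single w (Poly_Mapping.lookup x w))"
      by (rule lpa_eq_sum)
    then show ?thesis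
      by (simp only: sum_distrib_right[symmetric] poly_mapping_sum_monomials[symmetric])
  qed
  moreover have "y * u \<approx> 0" if "\<And>w. w \<in> verts G \<Longrightarrow> y * word_elem [Vert w] \<approx> 0" for y
    unfolding u_def sum_distrib_left lpa_eq_0_iff using that W
    by (intro kernel_sum) (auto simp: lpa_eq_0_iff)
  ultimately show ?thesis using that by blast
qed

text \<open>A nontrivial \<open>\<beta>\<close> loses its first edge or the product is 0; a trivial
  \<open>\<beta>\<close> stays trivial while \<open>\<alpha>\<close> grows or the product is 0. So
  the ghost length drops to at most \<open>M\<close>.\<close>

lemma normal_form_mult_edge:
  assumes "Poly_Mapping.keys x \<subseteq> path_ghost_words (Suc M) d" "f \<in> arcs G"
  obtains x' where "Poly_Mapping.keys x' \<subseteq> path_ghost_words M (d + 1)" "x * word_elem [Edge f] \<approx> x'"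
proof -
  have "\<exists>x'. Poly_Mapping.keys x' \<subseteq> path_ghost_words M (d + 1) \<and> x * word_elem [Edge f] \<approx> x'"
    using assms(1)
  proof (induction x rule: poly_mapping_monomial_induct)
    case zero
    show ?case by (intro exI[of _ 0]) simp
  next
    case (add x y)
    then obtain x' y' where
      "Poly_Mapping.keys x' \<subseteq> path_ghost_words M (d + 1)" "x * word_elem [Edge f] \<approx> x'"
      "Poly_Mapping.keys y' \<subseteq> path_ghost_words M (d + 1)" "y * word_elem [Edge f] \<approx> y'" by blast
    then show ?case
      using keys_add[of x' y'] lpa_eq_add[of "x * word_elem [Edge f]" x' "y * word_elem [Edge f]" y']
      by (intro exI[of _ "x' + y'"]) (auto simp: distrib_right)
  next
    case (single w c)
    then obtain a p v q b where w: "w = Word (path_ghost_word p v q)" and p: "awalk a p v" and q: "awalk b q v"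
      and len: "length q \<le> Suc M" "int (length p) - int (length q) = d"
      by (elim path_ghost_words_cases)
    have prod: "Poly_Mapping.single w c * word_elem [Edge f] =
        Poly_Mapping.single (Word (path_ghost_word p v q @ [Edge f])) c"
      by (simp add: w word_elem_def mult_single Word_plus)
    have witness: ?case if "awalk a' p' v'" "awalk b' q' v'" "length q' \<le> M"
        "int (length p') - int (length q') = d + 1"
        "word_elem (path_ghost_word p v q @ [Edge f]) \<approx> word_elem (path_ghost_word p' v' q')" for a' p' v' b' q'
    proof -
      have "Word (path_ghost_word p' v' q') \<in> path_ghost_words M (d + 1)"
        using that(1-4) by (rule path_ghost_wordsI)
      then show ?thesis
        unfolding prod using single_eq[OF that(5)]
        by (intro exI[of _ "Poly_Mapping.single (Word (path_ghost_word p' v' q')) c"]) (auto split: if_splits)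
    qed
    have zero: ?case if "word_elem (path_ghost_word p v q @ [Edge f]) \<approx> 0"
      unfolding prod using single_eq_0[OF that] by (intro exI[of _ 0]) simp
    show ?case
    proof (cases q)
      case Nil
      show ?thesis
      proof (cases "tail G f = v")
        case True
        then have "awalk a (p @ [f]) (head G f)" "awalk (head G f) [] (head G f)"
          using p assms(2) by (auto simp: awalk_Cons_iff awalk_Nil_iff)
        then show ?thesis
          using path_mult_edge[OF p assms(2) True] Nil len by (intro witness) auto
      next
        case False
        then have "tail G f \<noteq> b" using q Nil by (simp add: awalk_Nil_iff)
        then show ?thesis
          using path_ghost_mult_mismatch[OF p q, of "Edge f"] assms(2) by (intro zero) auto
      qed
    next
      case (Cons g q')
      show ?thesis
      proof (cases "f = g")
        case True
        have "awalk (head G g) q' v" using q Cons by (simp add: awalk_Cons_iff)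
        then show ?thesis
          using path_ghost_mult_edge[of a p v b g q'] p q Cons True len by (intro witness) auto
      next
        case False
        then show ?thesis
          using path_ghost_mult_other_edge[of a p v b g q' f] p q Cons assms(2) by (intro zero) auto
      qed
    qed
  qed
  then show ?thesis using that by blast
qed

text \<open>
  The summand \<open>y\<close> collects the terms \<open>\<alpha>\<beta>\<^sup>*\<close> of \<open>x\<close> with \<open>\<beta>\<close> the trivial path at \<open>w\<close>, and \<open>F\<close> the
  first edges of the nontrivial \<open>\<beta>\<close> starting at \<open>w\<close>.
\<close>

lemma mult_vertex_decomposition:
  assumes "Poly_Mapping.keys x \<subseteq> path_ghost_words M d" "w \<in> verts G"
  obtains y F where
    "Poly_Mapping.keys y \<subseteq> {Word (path_ghost_word p w []) | p. True} \<inter> path_ghost_words 0 d"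
    "finite F" "F \<subseteq> out_arcs G w"
    "\<And>F'. finite F' \<Longrightarrow> F \<subseteq> F' \<Longrightarrow> F' \<subseteq> out_arcs G w \<Longrightarrow>
      x * word_elem [Vert w] \<approx> y + (\<Sum>f\<in>F'. (x - y) * word_elem [Edge f] * word_elem [Ghost f])"
    "\<And>f. f \<in> out_arcs G w - F \<Longrightarrow> x * word_elem [Edge f] \<approx> y * word_elem [Edge f]"
proof -
  let ?Y = "{Word (path_ghost_word p w []) | p. True} \<inter> path_ghost_words 0 d"
  \<comment> \<open>The freedom to enlarge \<open>F\<close> makes the predicate additive: the sets
    belonging to two summands are both replaced by their union.\<close>
  define P where "P x y F \<longleftrightarrow> Poly_Mapping.keys y \<subseteq> ?Y \<and> finite F \<and> F \<subseteq> out_arcs G w \<and>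
    (\<forall>F'. finite F' \<longrightarrow> F \<subseteq> F' \<longrightarrow> F' \<subseteq> out_arcs G w \<longrightarrow>
      x * word_elem [Vert w] \<approx> y + (\<Sum>f\<in>F'. (x - y) * word_elem [Edge f] * word_elem [Ghost f])) \<and>
    (\<forall>f\<in>out_arcs G w - F. x * word_elem [Edge f] \<approx> y * word_elem [Edge f])"
    for x y F
  have P_keys: "Poly_Mapping.keys y \<subseteq> ?Y" and P_finite: "finite F" and P_subset: "F \<subseteq> out_arcs G w"
    and P_edge: "\<And>f. f \<in> out_arcs G w - F \<Longrightarrow> x * word_elem [Edge f] \<approx> y * word_elem [Edge f]"
    and P_vertex: "\<And>F'. finite F' \<Longrightarrow> F \<subseteq> F' \<Longrightarrow> F' \<subseteq> out_arcs G w \<Longrightarrow>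
      x * word_elem [Vert w] \<approx> y + (\<Sum>f\<in>F'. (x - y) * word_elem [Edge f] * word_elem [Ghost f])"
    if "P x y F" for x y F
    using that unfolding P_def by blast+
  have "\<exists>y F. P x y F"
    using assms(1)
  proof (induction x rule: poly_mapping_monomial_induct)
    case zero
    show ?case by (intro exI[of _ 0] exI[of _ "{}"]) (simp add: P_def)
  next
    case (add x1 x2)
    then obtain y1 F1 y2 F2 where P: "P x1 y1 F1" "P x2 y2 F2" by blast
    have "P (x1 + x2) (y1 + y2) (F1 \<union> F2)"
      unfolding P_def
    proof (intro conjI allI impI ballI)
      show "Poly_Mapping.keys (y1 + y2) \<subseteq> ?Y"
        using P[THEN P_keys] keys_add[of y1 y2] by blast
      show "finite (F1 \<union> F2)" "F1 \<union> F2 \<subseteq> out_arcs G w"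
        using P[THEN P_finite] P[THEN P_subset] by simp_all
      show "(x1 + x2) * word_elem [Edge f] \<approx> (y1 + y2) * word_elem [Edge f]"
        if "f \<in> out_arcs G w - (F1 \<union> F2)" for f
        using that unfolding distrib_right by (intro lpa_eq_add P[THEN P_edge]) auto
      fix F'
      assume F': "finite F'" "F1 \<union> F2 \<subseteq> F'" "F' \<subseteq> out_arcs G w"
      have "x1 * word_elem [Vert w] + x2 * word_elem [Vert w] \<approx>
          (y1 + (\<Sum>f\<in>F'. (x1 - y1) * word_elem [Edge f] * word_elem [Ghost f])) +
          (y2 + (\<Sum>f\<in>F'. (x2 - y2) * word_elem [Edge f] * word_elem [Ghost f]))"
        using F' by (intro lpa_eq_add P[THEN P_vertex]) auto
      also have "\<dots> = (y1 + y2) +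
          (\<Sum>f\<in>F'. ((x1 + x2) - (y1 + y2)) * word_elem [Edge f] * word_elem [Ghost f])"
        by (simp add: sum.distrib[symmetric] algebra_simps flip: distrib_right)
      finally show "(x1 + x2) * word_elem [Vert w] \<approx> (y1 + y2) +
          (\<Sum>f\<in>F'. ((x1 + x2) - (y1 + y2)) * word_elem [Edge f] * word_elem [Ghost f])"
        by (simp add: distrib_right)
    qed
    then show ?case by blast
  next
    case (single u c)
    then obtain a p v q b where u: "u = Word (path_ghost_word p v q)" and p: "awalk a p v" and q: "awalk b q v"
      and len: "length q \<le> M" "int (length p) - int (length q) = d"
      by (elim path_ghost_words_cases)
    let ?x = "Poly_Mapping.single u c"
    have prod: "?x * word_elem zs = Poly_Mapping.single (Word (path_ghost_word p v q @ zs)) c" for zs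
      by (simp add: u word_elem_def mult_single Word_plus)
    have out: "f \<in> arcs G" "tail G f = w" if "f \<in> out_arcs G w" for f
      using that by auto
    have ghost: "word_elem [Ghost f] \<in> lpa_carrier" if "f \<in> out_arcs G w" for f
      using that by (intro free_carrier_word_elem) auto
    show ?case
    proof (cases "b = w")
      case False
      have edge: "?x * word_elem [Edge f] \<approx> 0" if "f \<in> out_arcs G w" for f
        unfolding prod using path_ghost_mult_mismatch[OF p q, of "Edge f"] out[OF that] False
        by (intro single_eq_0) auto
      have sum: "(\<Sum>f\<in>F'. ?x * word_elem [Edge f] * word_elem [Ghost f]) \<approx> 0" if "F' \<subseteq> out_arcs G w" for F'
        using that by (intro lpa_eq_0_sum lpa_eq_0_mult_right[OF edge ghost]) blast+
      have vert: "?x * word_elem [Vert w] \<approx> 0"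
        unfolding prod using path_ghost_mult_mismatch[OF p q, of "Vert w"] assms(2) False
        by (intro single_eq_0) auto
      have "?x * word_elem [Vert w] \<approx> (\<Sum>f\<in>F'. ?x * word_elem [Edge f] * word_elem [Ghost f])"
        if "F' \<subseteq> out_arcs G w" for F'
        by (rule lpa_eq_trans[OF vert lpa_eq_sym[OF sum[OF that]]])
      then have "P ?x 0 {}"
        unfolding P_def using edge by auto
      then show ?thesis by blast
    next
      case b: True
      have vert: "?x * word_elem [Vert w] \<approx> ?x"
        unfolding prod using path_ghost_mult_vertex[OF p q] b unfolding u by (intro single_eq) simp
      show ?thesis
      proof (cases q)
        case Nil
        then have "v = w" using q b by (simp add: awalk_Nil_iff)
        then have "u \<in> ?Y"
          using p q len Nil path_ghost_wordsI[OF p q] by (auto simp: u)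
        then have "P ?x ?x {}"
          unfolding P_def using vert by (auto split: if_splits)
        then show ?thesis by blast
      next
        case (Cons g q')
        have q': "awalk (head G g) q' v" and g: "g \<in> out_arcs G w"
          using q b Cons by (auto simp: awalk_Cons_iff)
        have other: "?x * word_elem [Edge f] \<approx> 0" if "f \<in> out_arcs G w - {g}" for f
        proof -
          have "word_elem (path_ghost_word p v q @ [Edge f]) \<approx> 0"
            unfolding Cons by (rule path_ghost_mult_other_edge[OF p q[unfolded Cons]]) (use that in auto)
          then show ?thesis
            unfolding prod by (rule single_eq_0)
        qed
        \<comment> \<open>Multiplication by \<open>g\<close> strips the first edge from
          \<open>\<beta>\<close>, and \<open>g\<^sup>*\<close> restores it. Hence this term belongs
          to the sum over \<open>F'\<close>, with \<open>y = 0\<close> and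
          \<open>F = {g}\<close>.\<close>
        have "?x * word_elem [Edge g] \<approx> Poly_Mapping.single (Word (path_ghost_word p v q')) c"
          unfolding prod Cons by (intro single_eq path_ghost_mult_edge[OF p q[unfolded Cons]])
        from lpa_eq_mult_right[OF this ghost[OF g]]
        have "?x * word_elem [Edge g] * word_elem [Ghost g] \<approx>
            Poly_Mapping.single (Word (path_ghost_word p v q' @ [Ghost g])) c"
          by (simp add: word_elem_def mult_single Word_plus)
        then have same: "?x * word_elem [Edge g] * word_elem [Ghost g] \<approx> ?x"
          unfolding path_ghost_mult_ghost u Cons .
        have "?x * word_elem [Vert w] \<approx> (\<Sum>f\<in>F'. ?x * word_elem [Edge f] * word_elem [Ghost f])"
          if F': "finite F'" "{g} \<subseteq> F'" "F' \<subseteq> out_arcs G w" for F'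
        proof -
          have "(\<Sum>f\<in>F'. ?x * word_elem [Edge f] * word_elem [Ghost f]) \<approx> (\<Sum>f\<in>F'. if f = g then ?x else 0)"
          proof (rule lpa_eq_sum)
            fix f
            assume "f \<in> F'"
            then show "?x * word_elem [Edge f] * word_elem [Ghost f] \<approx> (if f = g then ?x else 0)"
              using same F' lpa_eq_0_mult_right[OF other ghost, of f f] by auto
          qed
          also have "\<dots> = ?x"
            using F' by simp
          finally show ?thesis
            using vert lpa_eq_sym lpa_eq_trans by blast
        qed
        then have "P ?x 0 {g}"
          unfolding P_def using other g by auto
        then show ?thesis by blast
      qed
    qed
  qed
  then obtain y F where P: "P x y F" by blast
  show ?thesis
    by (rule that[OF P_keys[OF P] P_finite[OF P] P_subset[OF P] P_vertex[OF P] P_edge[OF P]])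
qed

text \<open>Letters cancel from the middle outwards, and the first mismatch gives 0. Equal lengths
  ensure that nothing of either path is left over.\<close>

lemma ghost_path_mult_path:
  assumes "awalk b q u" "awalk a p v" "length q = length p"
  shows "word_elem (path_ghost_word [] u q @ path_ghost_word p v []) \<approx>
    (if q = p \<and> u = v then word_elem [Vert u] else 0)"
  using assms
proof (induction q arbitrary: a b p)
  case Nil
  then have "u \<in> verts G" "v \<in> verts G"
    by (auto dest: awalk_last_in_verts)
  then show ?case
    using Nil relation_eq[OF vert_idem] relation_eq_0[OF vert_orth]
    by (auto simp: path_ghost_word_def)
next
  case (Cons f q)
  then obtain g p' where p: "p = g # p'" and len: "length q = length p'" by (cases p) auto
  have f: "awalk (head G f) q u" "awalk u [] u" and g: "g \<in> arcs G" "awalk (head G g) p' v"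
    using Cons.prems by (auto simp: p awalk_Cons_iff awalk_Nil_iff dest: awalk_last_in_verts)
  have rest: "set (path_ghost_word p' v []) \<subseteq> lpa_gens G"
    using g awalk_last_in_verts[OF g(2)] by (intro path_ghost_word_gens) (auto simp: awalk_Nil_iff)
  have split: "path_ghost_word [] u (f # q) @ path_ghost_word p v [] =
      (path_ghost_word [] u (f # q) @ [Edge g]) @ path_ghost_word p' v []"
    by (simp add: path_ghost_word_def p)
  show ?case
  proof (cases "f = g")
    case True
    have "word_elem ((path_ghost_word [] u (f # q) @ [Edge g]) @ path_ghost_word p' v []) \<approx>
        word_elem (path_ghost_word [] u q @ path_ghost_word p' v [])"
      using word_eq_context[OF path_ghost_mult_edge[OF f(2) Cons.prems(1)] _ rest, of "[]"] True by simp
    also have "\<dots> \<approx> (if q = p' \<and> u = v then word_elem [Vert u] else 0)"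
      using Cons.IH[OF f(1) g(2) len] .
    finally show ?thesis
      unfolding split using True by (simp add: p)
  next
    case False
    then show ?thesis
      using word_eq_0_context[OF path_ghost_mult_other_edge[OF f(2) Cons.prems(1) g(1)] _ rest, of "[]"]
      unfolding split by (auto simp: p)
  qed
qed

text \<open>Without ghost parts, degree \<open>d\<close> forces all paths in \<open>y\<close> to
  have the same length, so \<open>q\<^sup>*\<close> kills every path except \<open>q\<close> and
  turns \<open>q\<close> into its range. Paths of other lengths could leave remainders.\<close>

lemma path_coefficient:
  assumes y: "Poly_Mapping.keys y \<subseteq> path_ghost_words 0 d"
    and q: "Word (path_ghost_word q u []) \<in> Poly_Mapping.keys y"
  shows "word_elem (path_ghost_word [] u q) * y \<approx>
      Poly_Mapping.single (Word [Vert u]) (Poly_Mapping.lookup y (Word (path_ghost_word q u [])))"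
    and "word_elem (path_ghost_word [] u q) \<in> lpa_carrier" and "u \<in> verts G"
proof -
  have inj: "path_ghost_word p v [] = path_ghost_word p' v' [] \<longleftrightarrow> p = p' \<and> v = v'" for p v p' v'
    by (auto simp: path_ghost_word_def dest!: map_injective[where f = Edge] intro: injI)
  let ?w = "Word (path_ghost_word q u [])"
  obtain b where b: "awalk b q u" "int (length q) = d"
    using subsetD[OF y q] by (elim path_ghost_words_cases) (auto simp: inj)
  have u: "awalk u [] u" "u \<in> verts G"
    using awalk_last_in_verts[OF b(1)] by (auto simp: awalk_Nil_iff)
  then show "word_elem (path_ghost_word [] u q) \<in> lpa_carrier" "u \<in> verts G"
    using path_ghost_word_gens[OF u(1) b(1)] by (auto intro: free_carrier_word_elem)
  let ?s = "word_elem (path_ghost_word [] u q)"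
  let ?c = "Poly_Mapping.lookup y"
  have "?s * Poly_Mapping.single w (?c w) \<approx>
      (if w = ?w then Poly_Mapping.single (Word [Vert u]) (?c w) else 0)"
    if w: "w \<in> Poly_Mapping.keys y" for w
  proof -
    obtain a p v where p: "w = Word (path_ghost_word p v [])" "awalk a p v" "int (length p) = d"
      using subsetD[OF y w] by (elim path_ghost_words_cases) auto
    have "?s * Poly_Mapping.single w (?c w) =
        Poly_Mapping.single 0 (?c w) * word_elem (path_ghost_word [] u q @ path_ghost_word p v [])"
      by (simp add: p(1) word_elem_def mult_single Word_plus)
    also have "\<dots> \<approx> Poly_Mapping.single 0 (?c w) * (if q = p \<and> u = v then word_elem [Vert u] else 0)"
      using b p by (intro lpa_eq_scale ghost_path_mult_path) auto
    also have "\<dots> = (if w = ?w then Poly_Mapping.single (Word [Vert u]) (?c w) else 0)"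
      by (auto simp: p(1) inj single_Word[of "[Vert u]"])
    finally show ?thesis .
  qed
  then have "(\<Sum>w\<in>Poly_Mapping.keys y. ?s * Poly_Mapping.single w (?c w)) \<approx>
      (\<Sum>w\<in>Poly_Mapping.keys y. if w = ?w then Poly_Mapping.single (Word [Vert u]) (?c w) else 0)"
    by (rule lpa_eq_sum)
  then show "?s * y \<approx> Poly_Mapping.single (Word [Vert u]) (?c ?w)"
    using q by (simp add: sum_distrib_left[symmetric] poly_mapping_sum_monomials[symmetric])
qed

lemma single_in_kernel_imp:
  assumes "Poly_Mapping.single (Word xs) c \<in> lpa_kernel G" "c \<noteq> (0 :: 'k)"
  shows "(word_elem xs :: ('a, 'b, 'k) lpa_free) \<in> lpa_kernel G"
  using kernel_scale[OF assms(1), of "inverse c"] assms(2) by (simp add: mult_single word_elem_def)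

text \<open>If a path \<open>q\<close> occurs in \<open>y\<close> with coefficient \<open>c\<close>,
  then \<open>q\<^sup>* y f = c f\<close>, and \<open>f\<close> is nonzero because
  \<open>f\<^sup>* f\<close> is a vertex.\<close>

lemma path_mult_edge_eq_0_imp:
  assumes "Poly_Mapping.keys y \<subseteq> {Word (path_ghost_word p w []) | p. True} \<inter> path_ghost_words 0 d"
    and "f \<in> out_arcs G w" "y * word_elem [Edge f] \<approx> 0" "countable (arcs G)"
  shows "y = 0"
proof (rule ccontr)
  assume "y \<noteq> 0"
  then obtain u where "u \<in> Poly_Mapping.keys y" by (metis all_not_in_conv keys_eq_empty)
  then obtain q where q: "Word (path_ghost_word q w []) \<in> Poly_Mapping.keys y" using assms(1) by blast
  let ?c = "Poly_Mapping.lookup y (Word (path_ghost_word q w []))"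
  have y: "Poly_Mapping.keys y \<subseteq> path_ghost_words 0 d" using assms(1) by blast
  note s = path_coefficient[OF y q]
  have f: "f \<in> arcs G" "tail G f = w" using assms(2) by auto
  then have E: "word_elem [Edge f] \<in> lpa_carrier" "word_elem [Ghost f] \<in> lpa_carrier"
    by (auto intro: free_carrier_word_elem)
  have "Poly_Mapping.single (Word [Vert w, Edge f]) ?c = Poly_Mapping.single (Word [Vert w]) ?c * word_elem [Edge f]"
    by (simp add: word_elem_def mult_single Word_plus)
  also have "\<dots> \<approx> word_elem (path_ghost_word [] w q) * y * word_elem [Edge f]"
    using lpa_eq_mult_right[OF lpa_eq_sym[OF s(1)] E(1)] .
  also have "\<dots> \<approx> 0"
    using lpa_eq_0_mult_left[OF assms(3) s(2)] by (simp add: mult.assoc)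
  finally have "word_elem [Vert w, Edge f] \<approx> 0"
    using single_in_kernel_imp q by (simp add: lpa_eq_0_iff in_keys_iff)
  then have "word_elem [Edge f] \<approx> 0"
    using lpa_eq_trans[OF lpa_eq_sym[OF letter_source_unit[of "Edge f"]]] f by simp
  then have "word_elem [Ghost f, Edge f] \<approx> 0"
    using lpa_eq_0_mult_left[OF _ E(2), of "word_elem [Edge f]"] by (simp add: word_elem_mult)
  then have "word_elem [Vert (head G f)] \<approx> 0"
    using lpa_eq_trans[OF lpa_eq_sym[OF relation_eq[OF ghost_edge_same[OF f(1)]]]] by blast
  then have "Poly_Mapping.single (Word [Vert (head G f)]) (1 :: 'k) \<in> lpa_kernel G"
    by (simp add: lpa_eq_0_iff word_elem_def)
  then show False
    using vertex_notin_kernel[OF assms(4), of "1 :: 'k"] by simp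
qed

lemma reduce_to_paths:
  assumes "countable (arcs G)" "Poly_Mapping.keys x \<subseteq> path_ghost_words M d" "\<not> x \<approx> 0"
  shows "\<exists>s y d'. s \<in> lpa_carrier \<and> Poly_Mapping.keys y \<subseteq> path_ghost_words 0 d' \<and> x * s \<approx> y \<and> \<not> y \<approx> 0"
  using assms(2,3)
proof (induction M arbitrary: x d)
  case 0
  obtain u where "u \<in> lpa_carrier" "x * u \<approx> x"
    using local_right_unit[OF path_ghost_words_carrier[OF 0(1)]] .
  then show ?case using 0 by blast
next
  case (Suc M)
  have x: "x \<in> lpa_carrier" using path_ghost_words_carrier[OF Suc.prems(1)] .
  show ?case
  proof (cases "\<exists>f\<in>arcs G. \<not> x * word_elem [Edge f] \<approx> 0")
    case True
    then obtain f where f: "f \<in> arcs G" "\<not> x * word_elem [Edge f] \<approx> 0" by blast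
    obtain x' where x': "Poly_Mapping.keys x' \<subseteq> path_ghost_words M (d + 1)" "x * word_elem [Edge f] \<approx> x'"
      using normal_form_mult_edge[OF Suc.prems(1) f(1)] .
    then have "\<not> x' \<approx> 0" using f(2) lpa_eq_trans by blast
    then obtain s y d' where s: "s \<in> lpa_carrier" "Poly_Mapping.keys y \<subseteq> path_ghost_words 0 d'"
        "x' * s \<approx> y" "\<not> y \<approx> 0"
      using Suc.IH[OF x'(1)] by blast
    have "x * (word_elem [Edge f] * s) \<approx> y"
      using lpa_eq_trans[OF lpa_eq_mult_right[OF x'(2) s(1)] s(3)] by (simp add: mult.assoc)
    moreover have "word_elem [Edge f] * s \<in> lpa_carrier"
      using f(1) s(1) by (intro free_carrier_mult free_carrier_word_elem) auto
    ultimately show ?thesis using s by blast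
  next
    case False
    then have edge: "x * word_elem [Edge f] \<approx> 0" if "f \<in> out_arcs G w" for f w
      using that by auto
    have ghost: "word_elem [Ghost f] \<in> lpa_carrier" if "f \<in> out_arcs G w" for f w
      using that by (intro free_carrier_word_elem) auto
    obtain u where u: "u \<in> lpa_carrier" "x * u \<approx> x"
      "\<And>y. (\<And>w. w \<in> verts G \<Longrightarrow> y * word_elem [Vert w] \<approx> 0) \<Longrightarrow> y * u \<approx> 0"
      using local_right_unit[OF x] by metis
    obtain w where w: "w \<in> verts G" "\<not> x * word_elem [Vert w] \<approx> 0"
      using u(2) u(3)[of x] Suc.prems(2) lpa_eq_sym lpa_eq_trans by blast
    obtain y F where y: "Poly_Mapping.keys y \<subseteq> {Word (path_ghost_word p w []) | p. True} \<inter> path_ghost_words 0 d"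
      and F: "finite F" "F \<subseteq> out_arcs G w"
      and vertex: "\<And>F'. finite F' \<Longrightarrow> F \<subseteq> F' \<Longrightarrow> F' \<subseteq> out_arcs G w \<Longrightarrow>
        x * word_elem [Vert w] \<approx> y + (\<Sum>f\<in>F'. (x - y) * word_elem [Edge f] * word_elem [Ghost f])"
      and fresh: "\<And>f. f \<in> out_arcs G w - F \<Longrightarrow> x * word_elem [Edge f] \<approx> y * word_elem [Edge f]"
      by (rule mult_vertex_decomposition[OF Suc.prems(1) w(1)]) (rule that)
    have out: "out_arcs G w = {}"
    proof (rule ccontr)
      assume nonempty: "out_arcs G w \<noteq> {}"
      have "x * word_elem [Vert w] \<approx> 0"
      proof (cases "finite (out_arcs G w)")
        case True
        have "word_elem [Vert w] \<approx> (\<Sum>f\<in>out_arcs G w. word_elem [Edge f, Ghost f])"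
          using relation_eq[OF regular_vert[OF w(1) nonempty True]] .
        from lpa_eq_mult_left[OF this x]
        have "x * word_elem [Vert w] \<approx> (\<Sum>f\<in>out_arcs G w. x * word_elem [Edge f] * word_elem [Ghost f])"
          by (simp add: sum_distrib_left mult.assoc word_elem_mult)
        also have "\<dots> \<approx> 0"
          by (intro lpa_eq_0_sum lpa_eq_0_mult_right[OF edge ghost])
        finally show ?thesis .
      next
        case False
        \<comment> \<open>Outside \<open>F\<close> the products of \<open>x\<close> and of
          \<open>y\<close> with an arc agree, so this arc tests \<open>y\<close> alone.\<close>
        then obtain f where f: "f \<in> out_arcs G w - F"
          using F(1) by (metis finite_subset subset_iff Diff_iff)
        then have "y * word_elem [Edge f] \<approx> 0"
          using lpa_eq_trans[OF lpa_eq_sym[OF fresh[OF f]] edge] by blast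
        then have "y = 0"
          using path_mult_edge_eq_0_imp[OF y _ _ assms(1)] f by blast
        then have "x * word_elem [Vert w] \<approx> (\<Sum>f\<in>F. x * word_elem [Edge f] * word_elem [Ghost f])"
          using vertex[OF F(1) order_refl F(2)] by simp
        also have "\<dots> \<approx> 0"
          using F(2) by (intro lpa_eq_0_sum lpa_eq_0_mult_right[OF edge ghost]) blast+
        finally show ?thesis .
      qed
      then show False using w(2) by blast
    qed
    \<comment> \<open>At a sink the set \<open>F\<close> is empty and no correction sum
      remains.\<close>
    then have "x * word_elem [Vert w] \<approx> y"
      using vertex[of "{}"] F by simp
    then show ?thesis
      using y w lpa_eq_trans free_carrier_word_elem[of "[Vert w]" "lpa_gens G"]
      by (intro exI[of _ "word_elem [Vert w]"] exI[of _ y] exI[of _ d]) auto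
  qed
qed

lemma graded_semiprime:
  assumes "countable (arcs G)" "x \<in> lpa_carrier" "hom_part d x = x"
    and "\<And>s. s \<in> lpa_carrier \<Longrightarrow> x * s * x \<approx> 0"
  shows "x \<approx> 0"
proof (rule ccontr)
  assume nonzero: "\<not> x \<approx> 0"
  obtain M x' where x': "Poly_Mapping.keys x' \<subseteq> path_ghost_words M d" "x \<approx> x'"
    using normal_form[OF assms(2,3)] .
  have "\<not> x' \<approx> 0" using nonzero x'(2) lpa_eq_trans by blast
  then obtain s y d' where s: "s \<in> lpa_carrier" "Poly_Mapping.keys y \<subseteq> path_ghost_words 0 d'"
      "x' * s \<approx> y" "\<not> y \<approx> 0"
    using reduce_to_paths[OF assms(1) x'(1)] by blast
  then have "y \<noteq> 0" by auto
  then obtain w where w: "w \<in> Poly_Mapping.keys y" by (metis all_not_in_conv keys_eq_empty)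
  obtain q u where wq: "w = Word (path_ghost_word q u [])"
    using subsetD[OF s(2) w] by (elim path_ghost_words_cases) auto
  define c where "c = Poly_Mapping.lookup y w"
  define r where "r = (word_elem (path_ghost_word [] u q) :: ('a, 'b, 'k) lpa_free)"
  define V where "V = (Poly_Mapping.single (Word [Vert u]) c :: ('a, 'b, 'k) lpa_free)"
  have c: "c \<noteq> 0" using w by (simp add: c_def in_keys_iff)
  have ry: "r * y \<approx> V" and r: "r \<in> lpa_carrier" and u: "u \<in> verts G"
    using path_coefficient[OF s(2), of q u] w unfolding r_def V_def c_def wq by auto
  have V: "V \<in> lpa_carrier" using u unfolding V_def by (intro free_carrier_single) auto
  have "x * s \<approx> y"
    using lpa_eq_trans[OF lpa_eq_mult_right[OF x'(2) s(1)] s(3)] .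
  from lpa_eq_trans[OF lpa_eq_mult_left[OF this r] ry]
  have rxs: "r * x * s \<approx> V" by (simp add: mult.assoc)
  have rxs_carrier: "r * x * s \<in> lpa_carrier"
    using r s(1) assms(2) by (intro free_carrier_mult)
  have "V * V \<approx> (r * x * s) * V"
    using lpa_eq_mult_right[OF lpa_eq_sym[OF rxs] V] .
  also have "\<dots> \<approx> (r * x * s) * (r * x * s)"
    using lpa_eq_mult_left[OF lpa_eq_sym[OF rxs] rxs_carrier] .
  also have "\<dots> = r * (x * (s * r) * x) * s"
    by (simp add: mult.assoc)
  also have "\<dots> \<approx> 0"
    by (rule lpa_eq_0_mult_right[OF lpa_eq_0_mult_left[OF assms(4)[OF free_carrier_mult[OF s(1) r]] r] s(1)])
  finally have "Poly_Mapping.single (Word [Vert u, Vert u]) (c * c) \<approx> 0"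
    by (simp add: V_def mult_single Word_plus)
  moreover have "Poly_Mapping.single (Word [Vert u, Vert u]) (c * c) \<approx> Poly_Mapping.single (Word [Vert u]) (c * c)"
    using relation_eq[OF vert_idem[OF u]] by (rule single_eq)
  ultimately have "Poly_Mapping.single (Word [Vert u]) (c * c) \<in> lpa_kernel G"
    using lpa_eq_sym lpa_eq_trans unfolding lpa_eq_0_iff[symmetric] by blast
  then show False
    using vertex_notin_kernel[OF assms(1), of "c * c"] c by simp
qed

section \<open>Homogeneous parts of annihilating elements\<close>

text \<open>
  Among the pairs of degrees violating the claim take one with \<open>i + j\<close> maximal and then \<open>j\<close>
  maximal. In the component of degree \<open>i + j + deg r\<close> of \<open>b * r * a\<close>, multiplied on the right
  by \<open>s * hom_part j a\<close>, only the chosen term survives.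
\<close>

lemma annihilating_hom_parts:
  assumes "countable (arcs G)" "a \<in> lpa_carrier" "b \<in> lpa_carrier"
    and zero: "\<And>r. r \<in> lpa_carrier \<Longrightarrow> b * r * a \<approx> 0"
    and "r \<in> lpa_carrier"
  shows "hom_part i b * r * hom_part j a \<approx> 0"
proof -
  define P where "P i j \<longleftrightarrow> (\<forall>r\<in>lpa_carrier. hom_part i b * r * hom_part j a \<approx> 0)" for i j
  have PD: "hom_part i b * r * hom_part j a \<approx> 0" if "P i j" "r \<in> lpa_carrier" for i j r
    using that by (simp add: P_def)
  note hom = hom_part_carrier[OF assms(2)] hom_part_carrier[OF assms(3)]
  \<comment> \<open>Restricting to degrees that occur keeps the set finite, so that maxima exist;
    for all other pairs one of the factors is 0.\<close>
  define V where "V = {(i, j). (i, j) \<in> degrees b \<times> degrees a \<and> \<not> P i j}"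
  have outside: "P i j" if "(i, j) \<notin> V" for i j
    using that hom_part_eq_0[of i b] hom_part_eq_0[of j a] by (auto simp: V_def P_def)
  have "finite V"
    by (rule finite_subset[of _ "degrees b \<times> degrees a"]) (auto simp: V_def)
  have "V = {}"
  proof (rule ccontr)
    assume "V \<noteq> {}"
    define k where "k = Max ((\<lambda>(i, j). i + j) ` V)"
    define S where "S = {j. (k - j, j) \<in> V}"
    define m where "m = Max S"
    have "k \<in> (\<lambda>(i, j). i + j) ` V"
      unfolding k_def using \<open>finite V\<close> \<open>V \<noteq> {}\<close> by (intro Max_in) auto
    then obtain i j where ij: "(i, j) \<in> V" "k = i + j"
      by auto
    then have "j \<in> S"
      by (simp add: S_def)
    moreover have "S \<subseteq> snd ` V"
      unfolding S_def by force
    ultimately have S: "S \<noteq> {}" "finite S"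
      using \<open>finite V\<close> finite_subset by auto
    have mV: "(k - m, m) \<in> V"
      using Max_in[OF S(2,1)] by (simp add: m_def S_def)
    have above: "P i j" if "i + j > k" for i j
    proof (rule outside)
      show "(i, j) \<notin> V"
      proof
        assume "(i, j) \<in> V"
        then have "(\<lambda>(i, j). i + j) (i, j) \<le> k"
          unfolding k_def using \<open>finite V\<close> by (intro Max_ge finite_imageI imageI)
        with that show False by simp
      qed
    qed
    have right: "P (k - j) j" if "j > m" for j
    proof (rule outside)
      show "(k - j, j) \<notin> V"
      proof
        assume "(k - j, j) \<in> V"
        then have "j \<le> m"
          unfolding m_def using S by (intro Max_ge) (auto simp: S_def)
        with that show False by simp
      qed
    qed
    define B where "B = hom_part (k - m) b"
    define A where "A = hom_part m a"
    have AB: "A \<in> lpa_carrier" "B \<in> lpa_carrier"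
      using hom by (auto simp: A_def B_def)
    \<comment> \<open>For homogeneous \<open>r\<close> each product of parts has a single degree, so
      one component of \<open>b * r * a\<close> collects exactly the pairs with
      \<open>i + j = k\<close>. Moreover \<open>B * r * A\<close> is then homogeneous, as
      \<open>graded_semiprime\<close> demands.\<close>
    have homogeneous: "B * r * A \<approx> 0" if r: "r \<in> lpa_carrier" "hom_part d r = r" for r :: "('a, 'b, 'k) lpa_free" and d
    proof -
      let ?D = "degrees b \<times> degrees a"
      have "b * r * a = (\<Sum>i\<in>degrees b. hom_part i b) * r * (\<Sum>j\<in>degrees a. hom_part j a)"
        by (simp add: sum_hom_part)
      also have "\<dots> = (\<Sum>(i, j)\<in>?D. hom_part i b * r * hom_part j a)"
        by (simp add: sum_distrib_left sum_distrib_right sum.cartesian_product[symmetric]) (rule sum.swap)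
      finally have expand: "b * r * a = (\<Sum>(i, j)\<in>?D. hom_part i b * r * hom_part j a)" .
      have deg: "hom_part (i + d + j) (hom_part i b * r * hom_part j a) = hom_part i b * r * hom_part j a" for i j
        using r(2) by (intro hom_part_mult) (auto simp: hom_part_hom_part)
      have "hom_part (k + d) (hom_part i b * r * hom_part j a) =
          (if i = k - j then hom_part i b * r * hom_part j a else 0)" for i j
        using hom_part_hom_part[of "k + d" "i + d + j" "hom_part i b * r * hom_part j a"] deg[of i j] by auto
      then have "hom_part (k + d) (b * r * a) =
          (\<Sum>x\<in>?D. if fst x = k - snd x then hom_part (fst x) b * r * hom_part (snd x) a else 0)"
        unfolding expand by (auto simp: case_prod_unfold intro!: sum.cong)
      moreover have "hom_part (k + d) (b * r * a) \<approx> 0"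
        using zero[OF r(1)] by (simp add: lpa_eq_0_iff kernel_hom_part)
      ultimately have component: "(\<Sum>x\<in>?D. if fst x = k - snd x then hom_part (fst x) b * r * hom_part (snd x) a else 0) \<approx> 0"
        by simp
      have step: "B * r * A * s * A \<approx> 0" if s: "s \<in> lpa_carrier" for s
      proof -
        have sA: "s * A \<in> lpa_carrier"
          using s AB by (intro free_carrier_mult)
        have "B * r * A * s * A = (\<Sum>x\<in>?D. if x = (k - m, m) then B * r * A * s * A else 0)"
          using mV by (simp add: V_def)
        also have "\<dots> \<approx> (\<Sum>x\<in>?D. (if fst x = k - snd x then hom_part (fst x) b * r * hom_part (snd x) a else 0) * (s * A))"
        proof (rule lpa_eq_sum)
          fix x
          assume "x \<in> ?D"
          obtain i j where x: "x = (i, j)" by (cases x)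
          \<comment> \<open>For \<open>j < m\<close>, regroup so that
            \<open>r * hom_part j a * s\<close> is the middle factor: the outer degrees
            \<open>k - j\<close> and \<open>m\<close> add up to more than \<open>k\<close>. For
            \<open>j > m\<close> the choice of \<open>m\<close> applies.\<close>
          have "hom_part (k - j) b * r * hom_part j a * (s * A) \<approx> 0" if "j \<noteq> m"
          proof (cases "j < m")
            case True
            have "r * hom_part j a * s \<in> lpa_carrier"
              using r s hom by (intro free_carrier_mult)
            then have "hom_part (k - j) b * (r * hom_part j a * s) * A \<approx> 0"
              unfolding A_def using True by (intro PD above) auto
            then show ?thesis by (simp add: mult.assoc)
          next
            case False
            then show ?thesis
              using that r sA by (intro lpa_eq_0_mult_right PD right) auto
          qed
          then show "(if x = (k - m, m) then B * r * A * s * A else 0) \<approx>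
              (if fst x = k - snd x then hom_part (fst x) b * r * hom_part (snd x) a else 0) * (s * A)"
            by (auto simp: x A_def B_def mult.assoc intro: lpa_eq_sym)
        qed
        also have "\<dots> \<approx> 0"
          unfolding sum_distrib_right[symmetric] by (rule lpa_eq_0_mult_right[OF component sA])
        finally show ?thesis .
      qed
      show ?thesis
      proof (rule graded_semiprime[OF assms(1)])
        show "B * r * A \<in> lpa_carrier"
          using AB r by (intro free_carrier_mult)
        show "hom_part ((k - m) + d + m) (B * r * A) = B * r * A"
          using r(2) unfolding A_def B_def by (intro hom_part_mult) (auto simp: hom_part_hom_part)
        fix s :: "('a, 'b, 'k) lpa_free"
        assume "s \<in> lpa_carrier"
        \<comment> \<open>With the middle factor \<open>s * B * r\<close> the product regroups as
          \<open>x * s * x\<close> for \<open>x = B * r * A\<close>.\<close>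
        then have "B * r * A * (s * B * r) * A \<approx> 0"
          using AB r by (intro step free_carrier_mult)
        then show "B * r * A * s * (B * r * A) \<approx> 0"
          by (simp add: mult.assoc)
      qed
    qed
    have "B * r * A \<approx> 0" if r: "r \<in> lpa_carrier" for r
    proof -
      have "(\<Sum>d\<in>degrees r. B * hom_part d r * A) \<approx> 0"
      proof (rule lpa_eq_0_sum)
        fix d
        show "B * hom_part d r * A \<approx> 0"
          using homogeneous[of "hom_part d r" d] hom_part_carrier[OF r] by (simp add: hom_part_hom_part)
      qed
      also have "(\<Sum>d\<in>degrees r. B * hom_part d r * A) = B * r * A"
        by (simp add: sum_distrib_left[symmetric] sum_distrib_right[symmetric] sum_hom_part)
      finally show ?thesis .
    qed
    then show False
      using mV by (simp add: V_def P_def A_def B_def)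
  qed
  then show ?thesis
    using outside[of i j] PD assms(5) by simp
qed

text \<open>There is no \<open>r = 1\<close> to insert, so semiprimeness is used once more: for
  \<open>x = b\<^sub>i a\<^sub>j\<close>, the product \<open>x s x\<close> is
  \<open>b\<^sub>i (a\<^sub>j s b\<^sub>i) a\<^sub>j\<close>.\<close>

lemma annihilating_hom_part:
  assumes "countable (arcs G)" "a \<in> lpa_carrier" "b \<in> lpa_carrier"
    and zero: "\<And>r. r \<in> lpa_carrier \<Longrightarrow> b * r * a \<approx> 0"
  shows "hom_part i b * hom_part j a \<approx> 0"
proof (rule graded_semiprime[OF assms(1)])
  note hom = hom_part_carrier[OF assms(2)] hom_part_carrier[OF assms(3)]
  show "hom_part i b * hom_part j a \<in> lpa_carrier"
    using hom by (intro free_carrier_mult)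
  show "hom_part (i + j) (hom_part i b * hom_part j a) = hom_part i b * hom_part j a"
    by (intro hom_part_mult) (auto simp: hom_part_hom_part)
  fix s :: "('a, 'b, 'k) lpa_free"
  assume "s \<in> lpa_carrier"
  then have "hom_part i b * (hom_part j a * s * hom_part i b) * hom_part j a \<approx> 0"
    using hom by (intro annihilating_hom_parts[OF assms] free_carrier_mult)
  then show "hom_part i b * hom_part j a * s * (hom_part i b * hom_part j a) \<approx> 0"
    by (simp add: mult.assoc)
qed

section \<open>Cosets\<close>

abbreviation LPA :: "(('a, 'b, 'k) lpa_elem, 'k) nu_algebra" where
  "LPA \<equiv> leavitt_path_algebra G"

definition lpa_class :: "('a, 'b, 'k) lpa_free \<Rightarrow> ('a, 'b, 'k) lpa_elem" where
  "lpa_class p = alg_coset (free_algebra (lpa_gens G)) (lpa_kernel G) p"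

lemma mem_lpa_class: "q \<in> lpa_class p \<longleftrightarrow> q \<approx> p"
  by (auto simp: lpa_class_def alg_coset_def lpa_eq_def intro: exI[of _ "q - p"])

lemma lpa_class_eq_iff: "lpa_class p = lpa_class q \<longleftrightarrow> p \<approx> q"
  using mem_lpa_class lpa_eq_refl lpa_eq_sym lpa_eq_trans by blast

lemma lpa_eq_carrier: "p \<approx> q \<Longrightarrow> q \<in> lpa_carrier \<Longrightarrow> p \<in> lpa_carrier"
  unfolding lpa_eq_def using free_carrier_add[OF kernel_carrier] by fastforce

lemma LPA_carrier: "carrier LPA = lpa_class ` lpa_carrier"
  by (simp add: leavitt_path_algebra_def alg_quotient_def lpa_class_def)

lemma LPA_zero: "alg_zero LPA = lpa_class 0"
  by (simp add: leavitt_path_algebra_def alg_quotient_def lpa_class_def)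

lemma LPA_zero_iff: "lpa_class p = alg_zero LPA \<longleftrightarrow> p \<approx> 0"
  by (simp add: LPA_zero lpa_class_eq_iff)

lemma LPA_add: "alg_add LPA (lpa_class p) (lpa_class q) = lpa_class (p + q)"
proof -
  have "alg_add LPA (lpa_class p) (lpa_class q) = (\<Union>x\<in>lpa_class p. \<Union>y\<in>lpa_class q. lpa_class (x + y))"
    by (simp add: leavitt_path_algebra_def alg_quotient_def lpa_class_def)
  also have "\<dots> = (\<Union>x\<in>lpa_class p. \<Union>y\<in>lpa_class q. lpa_class (p + q))"
    by (intro SUP_cong refl) (simp add: lpa_class_eq_iff mem_lpa_class lpa_eq_add)
  also have "\<dots> = lpa_class (p + q)"
    using mem_lpa_class[of p p] mem_lpa_class[of q q] by auto
  finally show ?thesis .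
qed

text \<open>The kernel absorbs factors from the carrier only. Other representatives of the two
  classes lie in the carrier as well, because the kernel does.\<close>

lemma LPA_mult:
  assumes "p \<in> lpa_carrier" "q \<in> lpa_carrier"
  shows "alg_mult LPA (lpa_class p) (lpa_class q) = lpa_class (p * q)"
proof -
  have "alg_mult LPA (lpa_class p) (lpa_class q) = (\<Union>x\<in>lpa_class p. \<Union>y\<in>lpa_class q. lpa_class (x * y))"
    by (simp add: leavitt_path_algebra_def alg_quotient_def lpa_class_def)
  also have "\<dots> = (\<Union>x\<in>lpa_class p. \<Union>y\<in>lpa_class q. lpa_class (p * q))"
  proof (intro SUP_cong refl)
    fix x y
    assume "x \<in> lpa_class p" "y \<in> lpa_class q"
    then have "x \<approx> p" "y \<approx> q" by (simp_all add: mem_lpa_class)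
    then show "lpa_class (x * y) = lpa_class (p * q)"
      unfolding lpa_class_eq_iff using assms lpa_eq_carrier lpa_eq_mult_left lpa_eq_mult_right
      by (meson lpa_eq_trans)
  qed
  also have "\<dots> = lpa_class (p * q)"
    using mem_lpa_class[of p p] mem_lpa_class[of q q] by auto
  finally show ?thesis .
qed

lemma LPA_scale: "alg_scale LPA c (lpa_class p) = lpa_class (Poly_Mapping.single 0 c * p)"
proof -
  have "alg_scale LPA c (lpa_class p) = (\<Union>x\<in>lpa_class p. lpa_class (Poly_Mapping.single 0 c * x))"
    by (simp add: leavitt_path_algebra_def alg_quotient_def lpa_class_def)
  also have "\<dots> = (\<Union>x\<in>lpa_class p. lpa_class (Poly_Mapping.single 0 c * p))"
    by (intro SUP_cong refl) (simp add: lpa_class_eq_iff mem_lpa_class lpa_eq_scale)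
  also have "\<dots> = lpa_class (Poly_Mapping.single 0 c * p)"
    using mem_lpa_class[of p p] by auto
  finally show ?thesis .
qed

lemma LPA_sum:
  assumes "finite S" "\<And>i. i \<in> S \<Longrightarrow> g i \<in> lpa_carrier" "\<And>i. i \<in> S \<Longrightarrow> f i = lpa_class (g i)"
  shows "alg_sum LPA f S = lpa_class (sum g S)"
proof -
  let ?M = "\<lparr>carrier = carrier LPA, mult = alg_add LPA, one = alg_zero LPA\<rparr>"
  interpret M: comm_monoid ?M
    by (rule comm_monoidI)
      (auto simp: LPA_carrier LPA_zero LPA_add free_carrier_zero free_carrier_add add_ac)
  show ?thesis
    using assms
  proof (induction S)
    case empty
    then show ?case by (simp add: alg_sum_def flip: LPA_zero)
  next
    case (insert i S)
    have "finprod ?M f (insert i S) = f i \<otimes>\<^bsub>?M\<^esub> finprod ?M f S"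
      using insert by (intro M.finprod_insert) (auto simp: LPA_carrier)
    then show ?case
      using insert by (simp add: alg_sum_def LPA_add)
  qed
qed

lemma LPA_span:
  assumes "\<And>x. x \<in> X \<Longrightarrow> rep x \<in> lpa_carrier" "\<And>x. x \<in> X \<Longrightarrow> lpa_class (rep x) = x"
  shows "alg_span LPA X =
    {lpa_class (\<Sum>x\<in>T. Poly_Mapping.single 0 (c x) * rep x) | c T. finite T \<and> T \<subseteq> X}"
proof -
  have "alg_sum LPA (\<lambda>x. alg_scale LPA (c x) x) T = lpa_class (\<Sum>x\<in>T. Poly_Mapping.single 0 (c x) * rep x)"
    if "finite T" "T \<subseteq> X" for c T
  proof (rule LPA_sum[OF that(1)])
    fix x
    assume "x \<in> T"
    then have x: "x \<in> X" using that(2) by blast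
    then show "Poly_Mapping.single 0 (c x) * rep x \<in> lpa_carrier"
      using assms(1) by (intro free_carrier_scale)
    show "alg_scale LPA (c x) x = lpa_class (Poly_Mapping.single 0 (c x) * rep x)"
      using LPA_scale[of "c x" "rep x"] assms(2)[OF x] by simp
  qed
  then show ?thesis
    unfolding alg_span_def by (intro Collect_cong ex_cong1) auto
qed

lemma path_last: "awalk a p v \<Longrightarrow> p \<noteq> [] \<Longrightarrow> head G (last p) = v"
  by (cases p rule: rev_cases) (auto simp: awalk_Cons_iff awalk_Nil_iff)

text \<open>\<open>lpa_path\<close> and \<open>lpa_path_star\<close> write a vertex for trivial
  paths only, \<open>path_ghost_word\<close> always writes the common range. Idempotence and the
  range relation make up the difference.\<close>

lemma path_mult_path_star:
  assumes "awalk a p v" "awalk b q v"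
  shows "word_elem ((if p = [] then [Vert a] else map Edge p) @ (if q = [] then [Vert b] else map Ghost (rev q)))
    \<approx> word_elem (path_ghost_word p v q)"
proof (cases "p = []")
  case True
  then have "a = v" "v \<in> verts G" using assms by (auto simp: awalk_Nil_iff)
  moreover have "b = v" if "q = []" using assms that by (auto simp: awalk_Nil_iff)
  ultimately show ?thesis
    using True relation_eq[OF vert_idem] by (auto simp: path_ghost_word_def)
next
  case p: False
  show ?thesis
  proof (cases "q = []")
    case True
    then have "b = v" using assms by (auto simp: awalk_Nil_iff)
    then show ?thesis using True p by (simp add: path_ghost_word_def)
  next
    case False
    have gens: "set (map Edge p) \<subseteq> lpa_gens G" "set (map Ghost (rev q)) \<subseteq> lpa_gens G"
      using assms by (auto simp: awalk_def)
    moreover have "letter_range (last (map Edge p)) = v"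
      using path_last[OF assms(1) p] p by (simp add: last_map)
    ultimately have "word_elem (map Edge p) \<approx> word_elem (map Edge p @ [Vert v])"
      using word_mult_vertex[THEN lpa_eq_sym, of "map Edge p"] p by simp
    from word_eq_context[OF this _ gens(2), of "[]"] show ?thesis
      using False p by (simp add: path_ghost_word_def)
  qed
qed

text \<open>This links the grading by spans to \<open>hom_part\<close>. One inclusion holds because
  the spanning products have homogeneous representatives, the other by
  \<open>normal_form\<close>.\<close>

lemma LPA_component: "lpa_component G n = lpa_class ` {p \<in> lpa_carrier. hom_part n p = p}"
proof -
  define X where "X = {lpa_path G u p \<boxtimes>\<^bsub>LPA\<^esub> lpa_path_star G w q | u p v w q x.
    awalk u p v \<and> awalk w q x \<and> int (length p) - int (length q) = n}"
  let ?path = "\<lambda>u p. if p = [] then [Vert u] else map Edge p"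
  let ?star = "\<lambda>w q. if q = [] then [Vert w] else map Ghost (rev q)"
  have product: "lpa_path G u p \<boxtimes>\<^bsub>LPA\<^esub> lpa_path_star G w q = lpa_class (word_elem (?path u p @ ?star w q))"
    and word: "word_elem (?path u p @ ?star w q) \<in> lpa_carrier"
    and degree: "word_degree (Word (?path u p @ ?star w q)) = int (length p) - int (length q)"
    if "awalk u p v" "awalk w q x" for u p v w q x
  proof -
    have gens: "set (?path u p) \<subseteq> lpa_gens G" "set (?star w q) \<subseteq> lpa_gens G"
      using that by (auto simp: awalk_def)
    then have "word_elem (?path u p) \<in> lpa_carrier" "word_elem (?star w q) \<in> lpa_carrier"
      by (auto intro!: free_carrier_word_elem)
    from LPA_mult[OF this] show "lpa_path G u p \<boxtimes>\<^bsub>LPA\<^esub> lpa_path_star G w q = lpa_class (word_elem (?path u p @ ?star w q))"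
      unfolding lpa_path_def lpa_path_star_def lpa_word_def lpa_class_def[symmetric] word_elem_mult .
    show "word_elem (?path u p @ ?star w q) \<in> lpa_carrier"
      using gens by (intro free_carrier_word_elem) auto
    \<comment> \<open>Vertices have degree 0, so \<open>u\<close> may stand in the middle even if it
      is not the range of \<open>p\<close>.\<close>
    have "word_degree (Word (?path u p @ ?star w q)) = word_degree (Word (path_ghost_word p u q))"
      by (simp add: word_degree_def path_ghost_word_def)
    then show "word_degree (Word (?path u p @ ?star w q)) = int (length p) - int (length q)"
      by (simp add: word_degree_path_ghost)
  qed
  have "\<exists>y. y \<in> lpa_carrier \<and> hom_part n y = y \<and> lpa_class y = x" if "x \<in> X" for x
  proof -
    from that obtain u p v w q z where x: "x = lpa_path G u p \<boxtimes>\<^bsub>LPA\<^esub> lpa_path_star G w q"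
      and walks: "awalk u p v" "awalk w q z" and n: "int (length p) - int (length q) = n"
      unfolding X_def by blast
    have "hom_part n (word_elem (?path u p @ ?star w q)) = word_elem (?path u p @ ?star w q)"
      by (simp only: word_elem_def hom_part_single degree[OF walks] n simp_thms if_True)
    then show ?thesis
      using word[OF walks] product[OF walks] x by metis
  qed
  then obtain rep where rep: "\<And>x. x \<in> X \<Longrightarrow> rep x \<in> lpa_carrier" "\<And>x. x \<in> X \<Longrightarrow> hom_part n (rep x) = rep x"
      "\<And>x. x \<in> X \<Longrightarrow> lpa_class (rep x) = x"
    by metis
  let ?sum = "\<lambda>c T. \<Sum>x\<in>T. Poly_Mapping.single 0 (c x) * rep x"
  have span: "lpa_component G n = {lpa_class (?sum c T) | c T. finite T \<and> T \<subseteq> X}"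
    unfolding lpa_component_def X_def[symmetric] using rep by (intro LPA_span)
  show ?thesis
  proof
    show "lpa_component G n \<subseteq> lpa_class ` {p \<in> lpa_carrier. hom_part n p = p}"
    proof -
      have "?sum c T \<in> lpa_carrier" "hom_part n (?sum c T) = ?sum c T" if "T \<subseteq> X" for c T
        using that rep by (auto simp: hom_part_single_mult intro!: free_carrier_sum free_carrier_scale sum.cong)
      then show ?thesis
        unfolding span by blast
    qed
    have "\<exists>c T. finite T \<and> T \<subseteq> X \<and> y \<approx> ?sum c T" if "Poly_Mapping.keys y \<subseteq> path_ghost_words M n" for y M
      using that
    proof (induction y rule: poly_mapping_monomial_induct)
      case zero
      show ?case by (intro exI[of _ "{}"] exI) simp
    next
      case (add y z)
      then obtain c T d U where *: "finite T" "T \<subseteq> X" "y \<approx> ?sum c T" "finite U" "U \<subseteq> X" "z \<approx> ?sum d U"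
        by blast
      \<comment> \<open>A span element has one coefficient per generator, so both families are
        extended by 0 to \<open>T \<union> U\<close> and added.\<close>
      define e where "e x = (if x \<in> T then c x else 0) + (if x \<in> U then d x else 0)" for x
      have "?sum c T = ?sum (\<lambda>x. if x \<in> T then c x else 0) (T \<union> U)"
        using * by (intro sum.mono_neutral_cong_left) auto
      moreover have "?sum d U = ?sum (\<lambda>x. if x \<in> U then d x else 0) (T \<union> U)"
        using * by (intro sum.mono_neutral_cong_left) auto
      ultimately have "?sum c T + ?sum d U = ?sum e (T \<union> U)"
        by (simp only: sum.distrib[symmetric] distrib_right[symmetric] single_add[symmetric] e_def)
      then have "y + z \<approx> ?sum e (T \<union> U)"
        using lpa_eq_add[OF *(3,6)] by simp
      then show ?case
        using * by (intro exI[of _ e] exI[of _ "T \<union> U"]) simp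
    next
      case (single w c)
      then obtain a p v q b where w: "w = Word (path_ghost_word p v q)" "awalk a p v" "awalk b q v"
          "int (length p) - int (length q) = n"
        by (elim path_ghost_words_cases)
      define x where "x = lpa_path G a p \<boxtimes>\<^bsub>LPA\<^esub> lpa_path_star G b q"
      have x: "x \<in> X" unfolding X_def x_def using w by blast
      have "lpa_class (rep x) = lpa_class (word_elem (path_ghost_word p v q))"
        unfolding rep(3)[OF x] unfolding x_def product[OF w(2,3)] lpa_class_eq_iff
        by (rule path_mult_path_star[OF w(2,3)])
      then have "word_elem (path_ghost_word p v q) \<approx> rep x"
        unfolding lpa_class_eq_iff by (rule lpa_eq_sym)
      then have "Poly_Mapping.single w c \<approx> Poly_Mapping.single 0 c * rep x"
        unfolding w(1) single_Word by (rule lpa_eq_scale)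
      then show ?case
        using x by (intro exI[of _ "\<lambda>_. c"] exI[of _ "{x}"]) simp
    qed
    then have combination: "\<exists>c T. finite T \<and> T \<subseteq> X \<and> lpa_class y = lpa_class (?sum c T)"
      if "Poly_Mapping.keys y \<subseteq> path_ghost_words M n" for y M
      using that unfolding lpa_class_eq_iff .
    show "lpa_class ` {p \<in> lpa_carrier. hom_part n p = p} \<subseteq> lpa_component G n"
    proof (rule image_subsetI)
      fix p :: "('a, 'b, 'k) lpa_free"
      assume "p \<in> {p \<in> lpa_carrier. hom_part n p = p}"
      then have p: "p \<in> lpa_carrier" "hom_part n p = p" by auto
      obtain M y where y: "Poly_Mapping.keys y \<subseteq> path_ghost_words M n" "p \<approx> y"
        using normal_form[OF p] .
      then show "lpa_class p \<in> lpa_component G n"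
        unfolding span using combination[OF y(1)] by (auto simp: lpa_class_eq_iff[THEN iffD2, OF y(2)])
    qed
  qed
qed

section \<open>Regular ideals\<close>

text \<open>For \<open>a\<close> in the annihilator of \<open>I\<close>, both \<open>b r\<close> and
  \<open>r b\<close> lie in \<open>I\<close>, hence \<open>b r a = 0\<close> and
  \<open>a r b = 0\<close>. So each part of \<open>b\<close> annihilates each part of
  \<open>a\<close> on both sides, and therefore lies in the double annihilator, which is
  \<open>I\<close>.\<close>

lemma regular_ideal_hom_part:
  assumes "countable (arcs G)" "regular_ideal LPA I" "b \<in> lpa_carrier" "lpa_class b \<in> I"
  shows "lpa_class (hom_part n b) \<in> I"
proof -
  have ideal: "alg_ideal LPA I" and I: "I = alg_perp LPA (alg_perp LPA I)"
    using assms(2) by (simp_all add: regular_ideal_def)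
  have hb: "hom_part n b \<in> lpa_carrier"
    using assms(3) by (rule hom_part_carrier)
  have "hom_part n b * a \<approx> 0 \<and> a * hom_part n b \<approx> 0"
    if a: "a \<in> lpa_carrier" "lpa_class a \<in> alg_perp LPA I" for a
  proof -
    have perp: "y * a \<approx> 0" "a * y \<approx> 0" if "y \<in> lpa_carrier" "lpa_class y \<in> I" for y
      using a that by (auto simp: alg_perp_def LPA_mult LPA_zero_iff)
    have "b * r * a \<approx> 0" "a * r * b \<approx> 0" if r: "r \<in> lpa_carrier" for r
    proof -
      have I: "lpa_class (b * r) \<in> I" "lpa_class (r * b) \<in> I"
        using ideal assms(3,4) r by (auto simp: alg_ideal_def LPA_carrier simp flip: LPA_mult)
      show "b * r * a \<approx> 0" "a * r * b \<approx> 0"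
        using perp(1)[OF free_carrier_mult[OF assms(3) r] I(1)]
          perp(2)[OF free_carrier_mult[OF r assms(3)] I(2)] by (simp_all add: mult.assoc)
    qed
    then have "hom_part n b * hom_part j a \<approx> 0" "hom_part j a * hom_part n b \<approx> 0" for j
      using annihilating_hom_part assms(1,3) a(1) by blast+
    then have "(\<Sum>j\<in>degrees a. hom_part n b * hom_part j a) \<approx> 0"
      "(\<Sum>j\<in>degrees a. hom_part j a * hom_part n b) \<approx> 0"
      by (auto intro: lpa_eq_0_sum)
    then show ?thesis
      by (simp add: sum_hom_part flip: sum_distrib_left sum_distrib_right)
  qed
  then have annihilates: "hom_part n b * a \<approx> 0" "a * hom_part n b \<approx> 0"
    if "a \<in> lpa_carrier" "lpa_class a \<in> alg_perp LPA I" for a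
    using that by blast+
  have "lpa_class (hom_part n b) \<in> alg_perp LPA (alg_perp LPA I)"
    unfolding alg_perp_def[of LPA "alg_perp LPA I"]
  proof (intro CollectI conjI ballI)
    show "lpa_class (hom_part n b) \<in> carrier LPA"
      using hb by (simp add: LPA_carrier)
    fix y
    assume y: "y \<in> alg_perp LPA I"
    then obtain a where a: "a \<in> lpa_carrier" "y = lpa_class a"
      by (auto simp: alg_perp_def LPA_carrier)
    then show "lpa_class (hom_part n b) \<boxtimes>\<^bsub>LPA\<^esub> y = alg_zero LPA"
      "y \<boxtimes>\<^bsub>LPA\<^esub> lpa_class (hom_part n b) = alg_zero LPA"
      using annihilates[OF a(1)] y hb by (simp_all add: LPA_mult LPA_zero_iff)
  qed
  then show ?thesis
    using I by simp
qed

lemma component_family: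
  assumes "\<And>i. f i \<in> lpa_component G i"
  obtains g where "\<And>i. hom_part i (g i) = g i" "\<And>i. f i = lpa_class (g i)"
    "\<And>D. finite D \<Longrightarrow> {i. f i \<noteq> alg_zero LPA} \<subseteq> D \<Longrightarrow>
      alg_sum LPA f {i. f i \<noteq> alg_zero LPA} = lpa_class (sum g D)"
proof -
  \<comment> \<open>Lifting the zero class to 0 itself allows two families with different supports
    to be summed over one common finite set.\<close>
  have "\<exists>p. p \<in> lpa_carrier \<and> hom_part i p = p \<and> f i = lpa_class p \<and> (f i = alg_zero LPA \<longrightarrow> p = 0)" for i
  proof (cases "f i = alg_zero LPA")
    case True
    then show ?thesis by (intro exI[of _ 0]) (simp add: LPA_zero free_carrier_zero)
  next
    case False
    then show ?thesis using assms[of i] by (auto simp: LPA_component)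
  qed
  then obtain g where g: "\<And>i. g i \<in> lpa_carrier" "\<And>i. hom_part i (g i) = g i" "\<And>i. f i = lpa_class (g i)"
      "\<And>i. f i = alg_zero LPA \<Longrightarrow> g i = 0"
    by metis
  have "alg_sum LPA f {i. f i \<noteq> alg_zero LPA} = lpa_class (sum g D)"
    if "finite D" "{i. f i \<noteq> alg_zero LPA} \<subseteq> D" for D
  proof -
    have "alg_sum LPA f {i. f i \<noteq> alg_zero LPA} = lpa_class (sum g {i. f i \<noteq> alg_zero LPA})"
      using finite_subset[OF that(2,1)] g(1,3) by (intro LPA_sum)
    also have "sum g {i. f i \<noteq> alg_zero LPA} = sum g D"
      using that g(4) by (intro sum.mono_neutral_left) auto
    finally show ?thesis .
  qed
  then show ?thesis
    by (rule that[OF g(2,3)])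
qed

lemma regular_ideal_direct_sum:
  assumes "countable (arcs G)" "regular_ideal LPA I"
  shows "internal_direct_sum LPA (\<lambda>n. I \<inter> lpa_component G n) I"
proof -
  have ideal: "alg_ideal LPA I"
    using assms(2) by (simp add: regular_ideal_def)
  have I_sum: "lpa_class (sum g S) \<in> I" if "finite S" "\<And>i. i \<in> S \<Longrightarrow> lpa_class (g i) \<in> I" for g and S :: "int set"
    using that
  proof (induction S)
    case empty
    then show ?case using ideal by (simp add: alg_ideal_def LPA_zero)
  next
    case (insert i S)
    then show ?case using ideal by (simp add: alg_ideal_def flip: LPA_add)
  qed
  let ?supp = "\<lambda>f. {i. f i \<noteq> alg_zero LPA}"
  let ?F = "{f. (\<forall>i. f i \<in> I \<inter> lpa_component G i) \<and> finite (?supp f)}"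
  show ?thesis
    unfolding internal_direct_sum_def
  proof (rule bij_betwI')
    fix f h
    assume f: "f \<in> ?F" and h: "h \<in> ?F"
    let ?D = "?supp f \<union> ?supp h"
    have D: "finite ?D" using f h by auto
    have f_comp: "\<And>i. f i \<in> lpa_component G i" using f by blast
    obtain g where
      g: "\<And>i. hom_part i (g i) = g i" "\<And>i. f i = lpa_class (g i)"
        and g_sum: "\<And>D. finite D \<Longrightarrow> ?supp f \<subseteq> D \<Longrightarrow> alg_sum LPA f (?supp f) = lpa_class (sum g D)"
      by (rule component_family[OF f_comp]) (rule that)
    have h_comp: "\<And>i. h i \<in> lpa_component G i" using h by blast
    obtain k where
      k: "\<And>i. hom_part i (k i) = k i" "\<And>i. h i = lpa_class (k i)"
        and k_sum: "\<And>D. finite D \<Longrightarrow> ?supp h \<subseteq> D \<Longrightarrow> alg_sum LPA h (?supp h) = lpa_class (sum k D)"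
      by (rule component_family[OF h_comp]) (rule that)
    show "(alg_sum LPA f (?supp f) = alg_sum LPA h (?supp h)) = (f = h)"
    proof
      assume "alg_sum LPA f (?supp f) = alg_sum LPA h (?supp h)"
      then have sum: "sum g ?D - sum k ?D \<in> lpa_kernel G"
        unfolding g_sum[OF D Un_upper1] k_sum[OF D Un_upper2] lpa_class_eq_iff lpa_eq_def .
      show "f = h"
      proof
        fix i
        show "f i = h i"
        proof (cases "i \<in> ?D")
          case True
          have pick: "hom_part i (sum l ?D) = l i" if "\<And>j. hom_part j (l j) = l j" for l
          proof -
            have "hom_part i (sum l ?D) = (\<Sum>j\<in>?D. if j = i then l i else 0)"
              unfolding hom_part_sum
            proof (intro sum.cong refl)
              fix j
              show "hom_part i (l j) = (if j = i then l i else 0)"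
                using hom_part_hom_part[of i j "l j"] that by auto
            qed
            also have "\<dots> = l i" using D True by simp
            finally show ?thesis .
          qed
          \<comment> \<open>Injectivity rests on the kernel being graded: congruent sums have
            congruent homogeneous parts.\<close>
          have "hom_part i (sum g ?D - sum k ?D) \<in> lpa_kernel G"
            using sum by (rule kernel_hom_part)
          then have "g i \<approx> k i"
            by (simp only: hom_part_diff pick[OF g(1)] pick[OF k(1)] lpa_eq_def)
          then show ?thesis
            by (simp add: g(2) k(2) lpa_class_eq_iff)
        qed auto
      qed
    qed simp
  next
    fix f
    assume f: "f \<in> ?F"
    then have fin: "finite (?supp f)" by blast
    have fI: "f i \<in> I" and f_comp: "f i \<in> lpa_component G i" for i
      using f by blast+
    obtain g where g: "\<And>i. hom_part i (g i) = g i" "\<And>i. f i = lpa_class (g i)"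
      and g_sum: "\<And>D. finite D \<Longrightarrow> ?supp f \<subseteq> D \<Longrightarrow> alg_sum LPA f (?supp f) = lpa_class (sum g D)"
      by (rule component_family[OF f_comp]) (rule that)
    have "lpa_class (sum g (?supp f)) \<in> I"
      using fin fI unfolding g(2) by (rule I_sum)
    then show "alg_sum LPA f (?supp f) \<in> I"
      using g_sum[OF fin order_refl] by simp
  next
    fix x
    assume x: "x \<in> I"
    then obtain b where b: "b \<in> lpa_carrier" "x = lpa_class b"
      using ideal by (auto simp: alg_ideal_def LPA_carrier)
    define f where "f i = lpa_class (hom_part i b)" for i
    have "f i \<in> I" for i
      using regular_ideal_hom_part[OF assms b(1)] x b(2) by (simp add: f_def)
    moreover have "f i \<in> lpa_component G i" for i
      unfolding LPA_component f_def using hom_part_carrier[OF b(1)] by (auto simp: hom_part_hom_part)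
    moreover have "f i = alg_zero LPA" if "i \<notin> degrees b" for i
      using hom_part_eq_0[OF that] by (simp add: f_def LPA_zero)
    then have supp: "?supp f \<subseteq> degrees b" by blast
    ultimately have f: "f \<in> ?F"
      using finite_subset[OF _ finite_degrees] by blast
    have "alg_sum LPA f (?supp f) = lpa_class (\<Sum>i\<in>?supp f. hom_part i b)"
      using f hom_part_carrier[OF b(1)] by (intro LPA_sum) (auto simp: f_def)
    \<comment> \<open>A nonzero part of \<open>b\<close> may lie in the kernel, so the support of
      \<open>f\<close> can be smaller than \<open>degrees b\<close>.\<close>
    also have "\<dots> = lpa_class (\<Sum>i\<in>degrees b. hom_part i b)"
    proof -
      have "(\<Sum>i\<in>degrees b - ?supp f. hom_part i b) \<approx> 0"
        by (rule lpa_eq_0_sum) (auto simp: f_def LPA_zero_iff)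
      from lpa_eq_add[OF this lpa_eq_refl[of "\<Sum>i\<in>?supp f. hom_part i b"]] show ?thesis
        unfolding lpa_class_eq_iff using sum.subset_diff[OF supp, of "\<lambda>i. hom_part i b"]
        by (simp add: lpa_eq_sym)
    qed
    also have "\<dots> = x"
      by (simp add: sum_hom_part b(2))
    finally show "\<exists>f\<in>?F. x = alg_sum LPA f (?supp f)"
      using f by blast
  qed
qed

end

theorem corollary3p4:
  fixes G :: "('v, 'e) pre_digraph"
    and I :: "('v, 'e, 'k::field) lpa_elem set"
  assumes "wf_digraph G"
    and "countable (verts G)"
    and "countable (arcs G)"
    and "regular_ideal (leavitt_path_algebra G) I"
  shows "internal_direct_sum (leavitt_path_algebra G) (\<lambda>n. I \<inter> lpa_component G n) I"
proof -
  interpret leavitt G "TYPE('k)"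
    using assms(1) by (rule leavitt.intro)
  show ?thesis
    using assms(3,4) by (rule regular_ideal_direct_sum)
qed

end
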